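(* Let $n\ge2$, $b_1,\dots,b_n\in\mathbb{R}^d$ with $\|b_i\|\le R'$ for all $i$ ($R'>0$), $B=\frac1n[b_1,\dots,b_n]^T\in\mathbb{R}^{n\times d}$, let each $g_i^*:\mathbb{R}\to\mathbb{R}\cup\{+\infty\}$ be proper, lower semicontinuous and convex, $g^*(y)=\frac1n\sum_{i=1}^n g_i^*(y_i)$, and let $\ell:\mathbb{R}^d\to\mathbb{R}\cup\{+\infty\}$ be proper, lower semicontinuous and $\sigma$-strongly convex ($\sigma\ge0$). Run the VRPDA$^2$ algorithm described in the context. Then for any $(u,v)\in\mathcal{X}\times\mathcal{Y}$ and $k=2,3,\dots,K$, $$\mathbb{E}[\mathrm{Gap}^{u,v}(\tilde x_k,\tilde y_k)]\le\frac{n(\|u-x_0\|^2+\|v-y_0\|^2)}{2A_k},$$ where $\tilde x_k=\frac1{A_k}\sum_{i=1}^k a_ix_i$ and $\tilde y_k=\frac{1}{A_k}\big(na_ky_k+\sum_{i=2}^{k-1}(na_i-(n-1)a_{i+1})y_i\big)$. Moreover, if $(x^*,y^* )$ is a primal-dual solution, then $$\mathbb{E}\Big[\frac n4\|y^*-y_k\|^2+\frac{n+\sigma A_k}{2}\|x^*-x_k\|^2\Big]\le\frac{n(\|x^*-x_0\|^2+\|y^*-y_0\|^2)}{2}.$$ In both cases $$A_k\ge\max\Big\{\frac{n-1}{2R'}\Big(1+\frac1{n-1}\Big)^k\mathbb{1}_{k\le k_0},\ \frac{(n-1)^2\sigma}{(4R')^2n}(k-k_0+n-1)^2\mathbb{1}_{k\ge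 k_0},\ \frac{n(k-K_0+n-1)}{2R'}\mathbb{1}_{k\ge K_0}\Big\},$$ where $\mathbb{1}$ is the indicator function, $K_0=\big\lceil\frac{\log n}{\log n-\log(n-1)}\big\rceil$, $k_0=\big\lceil\frac{\log B_{n,\sigma,R'}}{\log n-\log(n-1)}\big\rceil$, and $B_{n,\sigma,R'}=\frac{\sigma n(n-1)}{4R'}+\sqrt{\big(\frac{\sigma n(n-1)}{4R'}\big)^2+n^2}\ \ge n\max\{1,\frac{\sigma(n-1)}{2R'}\}$.
   Context: Norms are Euclidean; $\sigma$-strong convexity of $f$ means $f((1-\alpha)x+\alpha\hat x)\le(1-\alpha)f(x)+\alpha f(\hat x)-\frac\sigma2\alpha(1-\alpha)\|\hat x-x\|^2$ for all $x,\hat x$, $\alpha\in(0,1)$. Let $\mathcal{X}=\mathrm{dom}(\ell)$, $\mathcal{Y}=\mathrm{dom}(g^* )$, $L(x,y)=\langle Bx,y\rangle-g^*(y)+\ell(x)$, $\mathrm{Gap}^{u,v}(x,y)=L(x,v)-L(u,y)$; a primal-dual solution is a saddle point $(x^*,y^* )$ of $L$. For a vector $y$, $y_j$ or $y_{k,j}$ denotes the $j$-th coordinate (of $y$, resp. of $y_k$). VRPDA$^2$ algorithm: given $(x_0,y_0),(u,v)\in\mathcal{X}\times\mathcal{Y}$ and $K\ge2$: $\phi_0(x)=\frac12\|x-x_0\|^2$, $\psi_0(y)=\frac12\|y-y_0\|^2$, $a_0=A_0=0$, $\tilde a_1=\frac1{2R'}$; $\tilde\psi_1(y)=\psi_0(y)+\tilde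 a_1(\langle-Bx_0,y-v\rangle+g^*(y))$, $y_1=\arg\min\tilde\psi_1$; $z_1=B^Ty_1$; $\tilde\phi_1(x)=\phi_0(x)+\tilde a_1(\langle x-u,z_1\rangle+\ell(x))$, $x_1=\arg\min\tilde\phi_1$; $\psi_1=n\tilde\psi_1$, $\phi_1=n\tilde\phi_1$, $a_1=A_1=n\tilde a_1$, $a_2=\frac{a_1}{n-1}$, $A_2=A_1+a_2$. For $k=2,\dots,K$: $\bar x_{k-1}=x_{k-1}+\frac{a_{k-1}}{a_k}(x_{k-1}-x_{k-2})$; pick $j_k$ uniformly at random from $\{1,\dots,n\}$, independently of the past; $\psi_k(y)=\psi_{k-1}(y)+a_k(-b_{j_k}^T\bar x_{k-1}(y_{j_k}-v_{j_k})+g^*_{j_k}(y_{j_k}))$, $y_k=\arg\min_{y\in\mathbb{R}^n}\psi_k(y)$; $\phi_k(x)=\phi_{k-1}(x)+a_k(\langle x-u,z_{k-1}+(y_{k,j_k}-y_{k-1,j_k})b_{j_k}\rangle+\ell(x))$, $x_k=\arg\min_{x\in\mathbb{R}^d}\phi_k(x)$; $z_k=z_{k-1}+\frac1n(y_{k,j_k}-y_{k-1,j_k})b_{j_k}$; $a_{k+1}=\min\{(1+\frac1{n-1})a_k,\frac{\sqrt{n(n+\sigma A_k)}}{2R'}\}$, $A_{k+1}=A_k+a_{k+1}$. Expectations are over the random indices $j_2,j_3,\dots$. *)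

theory Defs
  imports "HOL-Analysis.Analysis"
begin

definition proper_fun :: "('a \<Rightarrow> ereal) \<Rightarrow> bool" where
  "proper_fun f \<longleftrightarrow> (\<forall>x. f x \<noteq> -\<infinity>) \<and> (\<exists>x. f x \<noteq> \<infinity>)"

definition lsc_fun :: "('a::topological_space \<Rightarrow> ereal) \<Rightarrow> bool" where
  "lsc_fun f \<longleftrightarrow> (\<forall>x. f x \<le> Liminf (at x) f)"

definition convex_fun :: "('a::real_vector \<Rightarrow> ereal) \<Rightarrow> bool" where
  "convex_fun f \<longleftrightarrow> (\<forall>x y \<alpha>. 0 < \<alpha> \<and> \<alpha> < 1 \<longrightarrow>
      f ((1 - \<alpha>) *\<^sub>R x + \<alpha> *\<^sub>R y) \<le> ereal (1 - \<alpha>) * f x + ereal \<alpha> * f y)"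

definition strongly_convex_fun :: "real \<Rightarrow> ('a::real_normed_vector \<Rightarrow> ereal) \<Rightarrow> bool" where
  "strongly_convex_fun \<sigma> f \<longleftrightarrow> (\<forall>x y \<alpha>. 0 < \<alpha> \<and> \<alpha> < 1 \<longrightarrow>
      f ((1 - \<alpha>) *\<^sub>R x + \<alpha> *\<^sub>R y) \<le> ereal (1 - \<alpha>) * f x + ereal \<alpha> * f y
         - ereal (\<sigma> / 2 * \<alpha> * (1 - \<alpha>) * (norm (y - x))\<^sup>2))"

definition edom :: "('a \<Rightarrow> ereal) \<Rightarrow> 'a set" where
  "edom f = {x. f x < \<infinity>}"

definition argmin :: "('a \<Rightarrow> ereal) \<Rightarrow> 'a" where
  "argmin f = (SOME x. \<forall>y. f x \<le> f y)"

definition Bmat :: "('n::finite \<Rightarrow> real^'d) \<Rightarrow> real^'d \<Rightarrow> real^'n" where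
  "Bmat b x = (\<chi> i. (b i \<bullet> x) / real CARD('n))"

definition BT :: "('n::finite \<Rightarrow> real^'d) \<Rightarrow> real^'n \<Rightarrow> real^'d" where
  "BT b y = (1 / real CARD('n)) *\<^sub>R (\<Sum>i\<in>UNIV. (y $ i) *\<^sub>R b i)"

definition gstar :: "('n::finite \<Rightarrow> real \<Rightarrow> ereal) \<Rightarrow> real^'n \<Rightarrow> ereal" where
  "gstar g y = ereal (1 / real CARD('n)) * (\<Sum>i\<in>UNIV. g i (y $ i))"

definition Lag :: "('n::finite \<Rightarrow> real^'d) \<Rightarrow> ('n \<Rightarrow> real \<Rightarrow> ereal) \<Rightarrow> (real^'d \<Rightarrow> ereal)
    \<Rightarrow> real^'d \<Rightarrow> real^'n \<Rightarrow> ereal" where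
  "Lag b g ell x y = ereal (Bmat b x \<bullet> y) - gstar g y + ell x"

definition Gap :: "('n::finite \<Rightarrow> real^'d) \<Rightarrow> ('n \<Rightarrow> real \<Rightarrow> ereal) \<Rightarrow> (real^'d \<Rightarrow> ereal)
    \<Rightarrow> real^'d \<Rightarrow> real^'n \<Rightarrow> real^'d \<Rightarrow> real^'n \<Rightarrow> ereal" where
  "Gap b g ell u v x y = Lag b g ell x v - Lag b g ell u y"

definition saddle_point :: "('n::finite \<Rightarrow> real^'d) \<Rightarrow> ('n \<Rightarrow> real \<Rightarrow> ereal) \<Rightarrow> (real^'d \<Rightarrow> ereal)
    \<Rightarrow> real^'d \<Rightarrow> real^'n \<Rightarrow> bool" where
  "saddle_point b g ell xs ys \<longleftrightarrow> xs \<in> edom ell \<and> ys \<in> edom (gstar g) \<and>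
     (\<forall>x\<in>edom ell. \<forall>y\<in>edom (gstar g).
        Lag b g ell xs y \<le> Lag b g ell xs ys \<and> Lag b g ell xs ys \<le> Lag b g ell x ys)"

fun stepsA :: "real \<Rightarrow> real \<Rightarrow> real \<Rightarrow> nat \<Rightarrow> real \<times> real" where
  "stepsA n R \<sigma> 0 = (0, 0)"
| "stepsA n R \<sigma> (Suc 0) = (n / (2 * R), n / (2 * R))"
| "stepsA n R \<sigma> (Suc (Suc 0)) = (n / (2 * R) / (n - 1), n / (2 * R) + n / (2 * R) / (n - 1))"
| "stepsA n R \<sigma> (Suc (Suc (Suc k))) =
     (let aA = stepsA n R \<sigma> (Suc (Suc k));
          a' = min ((1 + 1 / (n - 1)) * fst aA) (sqrt (n * (n + \<sigma> * snd aA)) / (2 * R))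
      in (a', snd aA + a'))"

definition ak :: "real \<Rightarrow> real \<Rightarrow> real \<Rightarrow> nat \<Rightarrow> real" where
  "ak n R \<sigma> k = fst (stepsA n R \<sigma> k)"

definition Ak :: "real \<Rightarrow> real \<Rightarrow> real \<Rightarrow> nat \<Rightarrow> real" where
  "Ak n R \<sigma> k = snd (stepsA n R \<sigma> k)"

text \<open>State after iteration k: (psi_k, phi_k, y_k, x_k, x_{k-1}, z_k).
  The random index j_k is js k.\<close>

type_synonym ('n, 'd) vr_state =
  "(real^'n \<Rightarrow> ereal) \<times> (real^'d \<Rightarrow> ereal) \<times> (real^'n) \<times> (real^'d) \<times> (real^'d) \<times> (real^'d)"

fun vrpda :: "('n::finite \<Rightarrow> real^'d) \<Rightarrow> ('n \<Rightarrow> real \<Rightarrow> ereal) \<Rightarrow> (real^'d \<Rightarrow> ereal)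
    \<Rightarrow> real \<Rightarrow> real \<Rightarrow> real^'d \<Rightarrow> real^'n \<Rightarrow> real^'d \<Rightarrow> real^'n \<Rightarrow> (nat \<Rightarrow> 'n) \<Rightarrow> nat
    \<Rightarrow> ('n, 'd) vr_state" where
  "vrpda b g ell R \<sigma> x0 y0 u v js 0 =
     ((\<lambda>y. ereal ((norm (y - y0))\<^sup>2 / 2)), (\<lambda>x. ereal ((norm (x - x0))\<^sup>2 / 2)), y0, x0, x0, BT b y0)"
| "vrpda b g ell R \<sigma> x0 y0 u v js (Suc 0) =
     (let n = real CARD('n);
          at1 = 1 / (2 * R);
          psit = (\<lambda>y. ereal ((norm (y - y0))\<^sup>2 / 2)
                    + ereal at1 * (ereal (- (Bmat b x0 \<bullet> (y - v))) + gstar g y));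
          y1 = argmin psit;
          z1 = BT b y1;
          phit = (\<lambda>x. ereal ((norm (x - x0))\<^sup>2 / 2)
                    + ereal at1 * (ereal ((x - u) \<bullet> z1) + ell x));
          x1 = argmin phit
      in ((\<lambda>y. ereal n * psit y), (\<lambda>x. ereal n * phit x), y1, x1, x0, z1))"
| "vrpda b g ell R \<sigma> x0 y0 u v js (Suc (Suc m)) =
     (case vrpda b g ell R \<sigma> x0 y0 u v js (Suc m) of (psi, phi, y, x, xp, z) \<Rightarrow>
       (let n = real CARD('n);
            k = Suc (Suc m);
            a = ak n R \<sigma> k;
            ap = ak n R \<sigma> (Suc m);
            xbar = x + (ap / a) *\<^sub>R (x - xp);
            j = js k;
            psi' = (\<lambda>y'. psi y' + ereal a * (ereal (- (b j \<bullet> xbar) * (y' $ j - v $ j)) + g j (y' $ j)));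
            y' = argmin psi';
            phi' = (\<lambda>x'. phi x' + ereal a * (ereal ((x' - u) \<bullet> (z + (y' $ j - y $ j) *\<^sub>R b j)) + ell x'));
            x' = argmin phi';
            z' = z + ((y' $ j - y $ j) / n) *\<^sub>R b j
        in (psi', phi', y', x', x, z')))"

definition yk :: "('n::finite \<Rightarrow> real^'d) \<Rightarrow> ('n \<Rightarrow> real \<Rightarrow> ereal) \<Rightarrow> (real^'d \<Rightarrow> ereal)
    \<Rightarrow> real \<Rightarrow> real \<Rightarrow> real^'d \<Rightarrow> real^'n \<Rightarrow> real^'d \<Rightarrow> real^'n \<Rightarrow> (nat \<Rightarrow> 'n) \<Rightarrow> nat \<Rightarrow> real^'n" where
  "yk b g ell R \<sigma> x0 y0 u v js k = fst (snd (snd (vrpda b g ell R \<sigma> x0 y0 u v js k)))"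

definition xk :: "('n::finite \<Rightarrow> real^'d) \<Rightarrow> ('n \<Rightarrow> real \<Rightarrow> ereal) \<Rightarrow> (real^'d \<Rightarrow> ereal)
    \<Rightarrow> real \<Rightarrow> real \<Rightarrow> real^'d \<Rightarrow> real^'n \<Rightarrow> real^'d \<Rightarrow> real^'n \<Rightarrow> (nat \<Rightarrow> 'n) \<Rightarrow> nat \<Rightarrow> real^'d" where
  "xk b g ell R \<sigma> x0 y0 u v js k = fst (snd (snd (snd (vrpda b g ell R \<sigma> x0 y0 u v js k))))"

definition xtil :: "('n::finite \<Rightarrow> real^'d) \<Rightarrow> ('n \<Rightarrow> real \<Rightarrow> ereal) \<Rightarrow> (real^'d \<Rightarrow> ereal)
    \<Rightarrow> real \<Rightarrow> real \<Rightarrow> real^'d \<Rightarrow> real^'n \<Rightarrow> real^'d \<Rightarrow> real^'n \<Rightarrow> (nat \<Rightarrow> 'n) \<Rightarrow> nat \<Rightarrow> real^'d" where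
  "xtil b g ell R \<sigma> x0 y0 u v js k =
     (let n = real CARD('n) in
      (1 / Ak n R \<sigma> k) *\<^sub>R (\<Sum>i=1..k. ak n R \<sigma> i *\<^sub>R xk b g ell R \<sigma> x0 y0 u v js i))"

definition ytil :: "('n::finite \<Rightarrow> real^'d) \<Rightarrow> ('n \<Rightarrow> real \<Rightarrow> ereal) \<Rightarrow> (real^'d \<Rightarrow> ereal)
    \<Rightarrow> real \<Rightarrow> real \<Rightarrow> real^'d \<Rightarrow> real^'n \<Rightarrow> real^'d \<Rightarrow> real^'n \<Rightarrow> (nat \<Rightarrow> 'n) \<Rightarrow> nat \<Rightarrow> real^'n" where
  "ytil b g ell R \<sigma> x0 y0 u v js k =
     (let n = real CARD('n) in
      (1 / Ak n R \<sigma> k) *\<^sub>R ((n * ak n R \<sigma> k) *\<^sub>R yk b g ell R \<sigma> x0 y0 u v js k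
        + (\<Sum>i=2..k-1. (n * ak n R \<sigma> i - (n - 1) * ak n R \<sigma> (i + 1)) *\<^sub>R yk b g ell R \<sigma> x0 y0 u v js i)))"

text \<open>Expectation over the independent uniform indices j_2,...,j_k (the quantities at
  iteration k depend only on these), as the uniform average over all index choices.\<close>

definition Exp_e :: "nat \<Rightarrow> ((nat \<Rightarrow> 'n::finite) \<Rightarrow> ereal) \<Rightarrow> ereal" where
  "Exp_e k X = ereal (1 / real CARD('n) ^ (k - 1)) * (\<Sum>js\<in>PiE {2..k} (\<lambda>_. UNIV). X js)"

definition Exp_r :: "nat \<Rightarrow> ((nat \<Rightarrow> 'n::finite) \<Rightarrow> real) \<Rightarrow> real" where
  "Exp_r k X = (1 / real CARD('n) ^ (k - 1)) * (\<Sum>js\<in>PiE {2..k} (\<lambda>_. UNIV). X js)"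

end

theory Submission
  imports Defs
begin

text \<open>
  The iterates minimise strongly convex estimate sequences \<open>\<psi>\<^sub>k\<close> and \<open>\<phi>\<^sub>k\<close>. Bounding their minima
  from above by the values at the comparison point and from below by the quadratic growth of the previous
  estimate around its minimiser, the bilinear coupling telescopes thanks to the extrapolation, and the
  leftover cross terms are absorbed by the growth terms because \<open>a\<^sub>k \<le> \<surd>(n (n + \<sigma> A\<^sub>k\<^sub>-\<^sub>1)) / (2 R)\<close>.
  This holds along every realisation of the random indices, up to terms \<open>a\<^sub>i (h(j\<^sub>i) - mean h)\<close> in which
  \<open>h\<close> depends only on \<open>j\<^sub>2, ..., j\<^sub>i\<^sub>-\<^sub>1\<close>; these average to zero. Jensen's inequality then gives the gap.
\<close>

section \<open>Step sizes\<close>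

text \<open>A step samples one coordinate, whereas the coupling and the gap involve whole vectors.
  Since y_k and y_{k-1} differ only at j_k, a sampled increment is n times the increment of the full
  quantity, and the dual part H of the gap enters as n H(y_i) - (n-1) H(y_{i-1}). Summation by parts
  turns this into the weights of \<open>ytil\<close>: the choice a_2 = a_1/(n-1) cancels y_1, and
  the first branch of the step size minimum keeps the weights nonnegative, as Jensen requires. The
  growth of psi_k around y_k is n/2 times a squared distance. The last coupling term, taken against
  the comparison point, costs half of it, which leaves the n/4 of the distance bound. The run is
  tied to (u,v), but the distance bound compares with a saddle point, so the pathwise inequality has
  to hold for every comparison point of the domain. The bounds on A_k concern the recursion alone:
  geometric growth with ratio n/(n-1) lasts until the second branch takes over, which happens when
  the powers of the ratio pass \<open>Bn\<close>; k_0 is the corresponding exponent.\<close>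

lemma Ak_0 [simp]: "Ak n R \<sigma> 0 = 0"
  and ak_1: "ak n R \<sigma> (Suc 0) = n / (2 * R)"
  and Ak_1: "Ak n R \<sigma> (Suc 0) = n / (2 * R)"
  and ak_2: "ak n R \<sigma> 2 = n / (2 * R) / (n - 1)"
  by (simp_all add: ak_def Ak_def numeral_2_eq_2)

lemma Ak_Suc: "Ak n R \<sigma> (Suc k) = Ak n R \<sigma> k + ak n R \<sigma> (Suc k)"
proof (cases "k < 2")
  case True
  then consider "k = 0" | "k = 1" by linarith
  then show ?thesis by cases (simp_all add: ak_def Ak_def)
next
  case False
  then obtain m where "k = Suc (Suc m)" by (metis add_2_eq_Suc le_Suc_ex not_less)
  then show ?thesis by (simp add: ak_def Ak_def Let_def)
qed

lemma ak_Suc: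
  assumes "k \<ge> 2"
  shows "ak n R \<sigma> (Suc k) =
    min ((1 + 1 / (n - 1)) * ak n R \<sigma> k) (sqrt (n * (n + \<sigma> * Ak n R \<sigma> k)) / (2 * R))"
proof -
  obtain m where "k = Suc (Suc m)" using assms by (metis add_2_eq_Suc le_Suc_ex)
  then show ?thesis by (simp add: ak_def Ak_def Let_def)
qed

locale step_sizes =
  fixes n R \<sigma> :: real
  assumes n2: "n \<ge> 2" and R: "R > 0" and sigma: "\<sigma> \<ge> 0"
begin

abbreviation "a \<equiv> ak n R \<sigma>"
abbreviation "A \<equiv> Ak n R \<sigma>"
abbreviation "q \<equiv> n / (n - 1)"
abbreviation "s \<equiv> \<sigma> * n * (n - 1) / (4 * R)"
abbreviation "Bn \<equiv> s + sqrt (s\<^sup>2 + n\<^sup>2)"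

lemma q_eq: "1 + 1 / (n - 1) = q"
  using n2 by (simp add: field_simps)

lemma q_gt_1: "q > 1"
  using n2 by (simp add: field_simps)

lemma ak_2': "a 2 = q / (2 * R)"
  by (simp add: ak_2 mult.commute)

lemma ak_Suc': "k \<ge> 2 \<Longrightarrow> a (Suc k) = min (q * a k) (sqrt (n * (n + \<sigma> * A k)) / (2 * R))"
  unfolding ak_Suc q_eq ..

lemma ak_Ak_pos: "a (Suc k) > 0 \<and> A (Suc k) > 0"
proof (induction k rule: less_induct)
  case (less k)
  consider "k = 0" | "k = 1" | "k \<ge> 2" by linarith
  then show ?case
  proof cases
    case 1
    then show ?thesis using n2 R by (simp add: ak_1 Ak_1)
  next
    case 2
    then show ?thesis using n2 R ak_2[of n R \<sigma>]
      by (simp add: Ak_Suc ak_1 numeral_2_eq_2 add_pos_pos)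
  next
    case 3
    then obtain m where m: "k = Suc m" by (cases k) auto
    have IH: "a k > 0" "A k > 0" using less.IH[of m] m by auto
    have "n * (n + \<sigma> * A k) > 0"
      using n2 sigma IH by (intro mult_pos_pos add_pos_nonneg) auto
    then have "a (Suc k) > 0" using IH n2 R q_gt_1 3 by (simp add: ak_Suc')
    then show ?thesis using IH by (simp add: Ak_Suc)
  qed
qed

lemma ak_pos: "k \<ge> 1 \<Longrightarrow> a k > 0"
  using ak_Ak_pos[of "k - 1"] by simp

lemma Ak_pos: "k \<ge> 1 \<Longrightarrow> A k > 0"
  using ak_Ak_pos[of "k - 1"] by simp

lemma Ak_nonneg: "A k \<ge> 0"
  using Ak_pos[of k] by (cases "k = 0") auto

text \<open>This is the bound that \<open>weighted_AM_GM\<close> needs. The recursion supplies it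
  only from index 3 on; a 1 and a 2 are prescribed, and there n \<le> sqrt(n (n + \<sigma> A))
  together with q \<le> n suffices.\<close>

lemma ak_le_sqrt: "a (Suc k) \<le> sqrt (n * (n + \<sigma> * A k)) / (2 * R)"
proof -
  have ge: "n \<le> sqrt (n * (n + \<sigma> * A k))"
    using n2 sigma Ak_nonneg[of k] by (intro real_le_rsqrt) (simp add: power2_eq_square)
  consider "k = 0" | "k = 1" | "k \<ge> 2" by linarith
  then show ?thesis
  proof cases
    case 1
    then show ?thesis using n2 by (simp add: ak_1 real_sqrt_mult)
  next
    case 2
    have "q \<le> n" using n2 by (simp add: field_simps)
    then have "a 2 \<le> n / (2 * R)"
      using R unfolding ak_2' by (intro divide_right_mono) auto
    also have "\<dots> \<le> sqrt (n * (n + \<sigma> * A k)) / (2 * R)"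
      using ge R by (simp add: divide_right_mono)
    finally show ?thesis using 2 by (simp add: numeral_2_eq_2)
  next
    case 3
    then show ?thesis by (simp add: ak_Suc')
  qed
qed

lemma ak_Suc_le: "k \<ge> 2 \<Longrightarrow> (n - 1) * a (Suc k) \<le> n * a k"
proof -
  assume "k \<ge> 2"
  then have "a (Suc k) \<le> q * a k" by (simp add: ak_Suc')
  then show ?thesis using n2 by (simp add: field_simps)
qed

section \<open>Geometric, quadratic and linear growth of the step sizes\<close>

lemma s_nonneg: "s \<ge> 0"
  using n2 R sigma by (simp add: mult_nonneg_nonneg)

lemma Bn_ge: "Bn \<ge> n * max 1 (\<sigma> * (n - 1) / (2 * R))"
proof -
  have "sqrt (s\<^sup>2 + n\<^sup>2) \<ge> n" "sqrt (s\<^sup>2 + n\<^sup>2) \<ge> s"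
    by (rule real_sqrt_sum_squares_ge2 real_sqrt_sum_squares_ge1)+
  moreover have "n * (\<sigma> * (n - 1) / (2 * R)) = s + s"
    using R by (simp add: field_simps)
  moreover have "n * max 1 (\<sigma> * (n - 1) / (2 * R)) = n \<or>
      n * max 1 (\<sigma> * (n - 1) / (2 * R)) = n * (\<sigma> * (n - 1) / (2 * R))"
    by (auto simp: max_def)
  ultimately show ?thesis using s_nonneg by linarith
qed

lemma Bn_ge_n: "Bn \<ge> n" and Bn_ge_sigma: "Bn \<ge> n * (\<sigma> * (n - 1) / (2 * R))"
proof -
  have "n * max 1 (\<sigma> * (n - 1) / (2 * R)) \<ge> n * 1"
    "n * max 1 (\<sigma> * (n - 1) / (2 * R)) \<ge> n * (\<sigma> * (n - 1) / (2 * R))"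
    using n2 by (intro mult_left_mono max.cobounded1 max.cobounded2; linarith)+
  then show "Bn \<ge> n" "Bn \<ge> n * (\<sigma> * (n - 1) / (2 * R))" using Bn_ge by linarith+
qed

text \<open>\<^term>\<open>Bn\<close> is the positive root of \<open>t\<^sup>2 = n\<^sup>2 + 2 s t\<close>, the point at which the two branches of
  the step size recursion coincide during geometric growth.\<close>

lemma le_Bn_iff:
  assumes "t > 0"
  shows "t \<le> Bn \<longleftrightarrow> t\<^sup>2 \<le> n\<^sup>2 + 2 * s * t"
proof -
  have "t \<le> Bn \<longleftrightarrow> t - s \<le> sqrt (s\<^sup>2 + n\<^sup>2)" by linarith
  also have "\<dots> \<longleftrightarrow> (t - s)\<^sup>2 \<le> s\<^sup>2 + n\<^sup>2"
  proof
    assume h: "t - s \<le> sqrt (s\<^sup>2 + n\<^sup>2)"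
    show "(t - s)\<^sup>2 \<le> s\<^sup>2 + n\<^sup>2"
    proof (cases "t \<ge> s")
      case True
      then have "(t - s)\<^sup>2 \<le> (sqrt (s\<^sup>2 + n\<^sup>2))\<^sup>2" using h by (intro power_mono) auto
      then show ?thesis by simp
    next
      case False
      then have "(s - t)\<^sup>2 \<le> s\<^sup>2" using assms by (intro power_mono) auto
      then show ?thesis by (simp add: power2_commute add_increasing2)
    qed
  qed (rule real_le_rsqrt)
  also have "\<dots> \<longleftrightarrow> t\<^sup>2 \<le> n\<^sup>2 + 2 * s * t" unfolding power2_diff by (auto simp: algebra_simps)
  finally show ?thesis .
qed

lemma sqrt_branch_geometric:
  "n * (n + \<sigma> * ((n - 1) / (2 * R) * t)) = n\<^sup>2 + 2 * s * t"
  using R by (simp add: field_simps power2_eq_square)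

text \<open>Along geometric growth the radicand of the second branch is n^2 + 2 s q^i, so that
  branch is at least q^i / (2R) = q * a i exactly while q^i \<le> \<open>Bn\<close>, and the minimum
  keeps choosing the first branch.\<close>

lemma Ak_geometric:
  assumes "k \<ge> 2" "\<And>i. i < k \<Longrightarrow> q ^ i \<le> Bn"
  shows "A k = (n - 1) / (2 * R) * q ^ k \<and> a k = q ^ (k - 1) / (2 * R)"
  using assms
proof (induction k rule: dec_induct)
  case base
  have "A 2 = n / (2 * R) + a 2"
    using Ak_Suc[of n R \<sigma> 1] by (simp add: Ak_1 numeral_2_eq_2)
  also have "\<dots> = (n + q) / (2 * R)" by (simp add: ak_2' add_divide_distrib)
  also have "n + q = (n - 1) * q\<^sup>2"
    using n2 by (simp add: divide_simps) (simp add: algebra_simps power2_eq_square)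
  finally show ?case by (simp add: ak_2')
next
  case (step k)
  have IH: "A k = (n - 1) / (2 * R) * q ^ k" "a k = q ^ (k - 1) / (2 * R)"
    using step by auto
  have qk: "q * q ^ (k - 1) = q ^ k" using step.hyps(1) by (cases k) auto
  have pos: "q ^ k > 0" using q_gt_1 by (intro zero_less_power) linarith
  have "(q ^ k)\<^sup>2 \<le> n\<^sup>2 + 2 * s * q ^ k"
    using le_Bn_iff[OF pos] step.prems[of k] by simp
  then have "q ^ k \<le> sqrt (n * (n + \<sigma> * A k))"
    unfolding IH sqrt_branch_geometric by (rule real_le_rsqrt)
  then have "q ^ k / (2 * R) \<le> sqrt (n * (n + \<sigma> * A k)) / (2 * R)"
    using R by (simp add: divide_right_mono)
  moreover have "q * a k = q ^ k / (2 * R)" unfolding IH qk[symmetric] by simp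
  ultimately have aS: "a (Suc k) = q ^ k / (2 * R)"
    using step.hyps(1) by (simp only: ak_Suc' min_absorb1)
  have "A (Suc k) = (n - 1) / (2 * R) * q ^ k + q ^ k / (2 * R)"
    by (simp only: Ak_Suc IH aS)
  also have "\<dots> = (n - 1) / (2 * R) * (q * q ^ k)"
    using n2 R by (simp add: field_simps)
  finally show ?case using aS by simp
qed

lemma Ak_geometric':
  assumes "k \<ge> 1" "\<And>i. i < k \<Longrightarrow> q ^ i \<le> Bn"
  shows "A k = (n - 1) / (2 * R) * q ^ k"
proof (cases "k = 1")
  case True
  then show ?thesis using n2 by (simp add: Ak_1)
next
  case False
  then show ?thesis using Ak_geometric[of k] assms by auto
qed

lemma Ak_mono: "i \<le> k \<Longrightarrow> A i \<le> A k"
proof (induction k rule: dec_induct)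
  case (step k)
  then show ?case using ak_pos[of "Suc k"] by (simp add: Ak_Suc)
qed simp

text \<open>Once the square root is the smaller branch it stays so:
  \<open>X = n + \<sigma> * A k\<close> grows by at most the factor q in a step, hence its root by
  at most q, which is the growth that the other branch would allow.\<close>

lemma ak_sqrt_branch:
  assumes "\<sigma> > 0" "m \<ge> 2" "\<And>i. i < m \<Longrightarrow> q ^ i \<le> Bn" "Bn \<le> q ^ m" "k \<ge> m"
  shows "a (Suc k) = sqrt (n * (n + \<sigma> * A k)) / (2 * R)"
  using \<open>k \<ge> m\<close>
proof (induction k rule: dec_induct)
  case base
  have geo: "A m = (n - 1) / (2 * R) * q ^ m" "a m = q ^ (m - 1) / (2 * R)"
    using Ak_geometric[OF assms(2), OF assms(3)] by simp_all
  have qm: "q * q ^ (m - 1) = q ^ m" using assms(2) by (cases m) auto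
  have pos: "q ^ m > 0" using q_gt_1 by (intro zero_less_power) linarith
  have "n\<^sup>2 + 2 * s * q ^ m \<le> (q ^ m)\<^sup>2"
  \<comment> \<open>\<open>le_Bn_iff\<close> yields the reversed inequality only strictly above
    \<open>Bn\<close>; at \<open>Bn\<close> itself the quadratic equation holds.\<close>
  proof (cases "q ^ m = Bn")
    case True
    have "(c + r)\<^sup>2 = n\<^sup>2 + 2 * c * (c + r)" if "r\<^sup>2 = c\<^sup>2 + n\<^sup>2" for c r :: real
      using that by (simp add: algebra_simps power2_eq_square)
    then have "Bn\<^sup>2 = n\<^sup>2 + 2 * s * Bn" by simp
    then show ?thesis unfolding True by simp
  next
    case False
    then show ?thesis using assms(4) le_Bn_iff[OF pos] by auto
  qed
  then have "sqrt (n * (n + \<sigma> * A m)) \<le> sqrt ((q ^ m)\<^sup>2)"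
    unfolding geo(1) sqrt_branch_geometric by (rule real_sqrt_le_mono)
  also have "\<dots> = q ^ m" using pos by simp
  finally have "sqrt (n * (n + \<sigma> * A m)) / (2 * R) \<le> q ^ m / (2 * R)"
    using R by (simp add: divide_right_mono)
  also have "\<dots> = q * a m" unfolding geo(2) qm[symmetric] by simp
  finally show ?case using assms(2) by (simp only: ak_Suc' min_absorb2)
next
  case (step k)
  define X where "X = n + \<sigma> * A k"
  \<comment> \<open>The phase starts with A m large enough (via \<open>Bn_ge_sigma\<close>) to give
    \<sigma> * a (Suc k) \<le> X / (n - 1), the growth estimate for X.\<close>
  have "A k \<ge> A m" using step.hyps by (simp add: Ak_mono)
  also have "A m = (n - 1) / (2 * R) * q ^ m" using Ak_geometric[OF assms(2), OF assms(3)] by simp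
  also have "\<dots> \<ge> (n - 1) / (2 * R) * (n * (\<sigma> * (n - 1) / (2 * R)))"
    using assms(4) Bn_ge_sigma n2 R by (intro mult_left_mono) auto
  finally have Ak: "A k \<ge> n * (n - 1)\<^sup>2 * \<sigma> / (2 * R)\<^sup>2"
    by (simp add: power2_eq_square algebra_simps)
  have X: "X > 0" unfolding X_def using n2 sigma Ak_nonneg[of k] by (simp add: add_pos_nonneg)
  have aS: "a (Suc k) = sqrt n * sqrt X / (2 * R)"
    using step.IH by (simp add: X_def real_sqrt_mult)
  have "(\<sigma> * sqrt n * (n - 1) / (2 * R))\<^sup>2 = \<sigma> * (n * (n - 1)\<^sup>2 * \<sigma> / (2 * R)\<^sup>2)"
    using n2 by (simp add: power_mult_distrib power_divide power2_eq_square)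
  also have "\<dots> \<le> X" unfolding X_def
    using mult_left_mono[OF Ak sigma] n2 by linarith
  finally have "\<sigma> * sqrt n * (n - 1) / (2 * R) \<le> sqrt X" by (rule real_le_rsqrt)
  then have "\<sigma> * sqrt n / (2 * R) \<le> sqrt X / (n - 1)" using n2 by (simp add: field_simps)
  then have "\<sigma> * sqrt n / (2 * R) * sqrt X \<le> sqrt X / (n - 1) * sqrt X"
    using X by (intro mult_right_mono) auto
  then have "\<sigma> * a (Suc k) \<le> X / (n - 1)"
    unfolding aS using X by simp
  then have "n + \<sigma> * A (Suc k) \<le> X + X / (n - 1)"
    unfolding X_def by (simp add: Ak_Suc distrib_left)
  also have "\<dots> = X * q" using n2 by (simp add: field_simps)
  also have "\<dots> \<le> X * q * q" 
  proof -
    have "0 \<le> X * q" using X q_gt_1 by (intro mult_nonneg_nonneg) linarith+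
    then show ?thesis using mult_left_mono[of 1 q "X * q"] q_gt_1 by linarith
  qed
  finally have "n * (n + \<sigma> * A (Suc k)) \<le> n * (X * q * q)"
    using n2 by (intro mult_left_mono) auto
  also have "n * (X * q * q) = q\<^sup>2 * (n * X)" by (simp add: power2_eq_square)
  finally have "sqrt (n * (n + \<sigma> * A (Suc k))) \<le> sqrt (q\<^sup>2 * (n * X))"
    by (rule real_sqrt_le_mono)
  also have "\<dots> = q * sqrt (n * X)" using q_gt_1 n2 by (simp only: real_sqrt_mult) simp
  finally have "sqrt (n * (n + \<sigma> * A (Suc k))) / (2 * R) \<le> q * sqrt (n * X) / (2 * R)"
    using R by (intro divide_right_mono) auto
  also have "\<dots> = q * a (Suc k)" using step.IH by (simp add: X_def)
  finally have le: "sqrt (n * (n + \<sigma> * A (Suc k))) / (2 * R) \<le> q * a (Suc k)" .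
  have "Suc k \<ge> 2" using step.hyps assms(2) by simp
  from ak_Suc'[OF this] show ?case using le by (simp only: min_absorb2)
qed

text \<open>The continuous model A' = sqrt(n \<sigma> A) / (2R) has the solution n \<sigma> t^2 /
  (4R)^2. The constant here is smaller by ((n-1)/n)^2, and this slack pays for the discrete
  increment 2M + 1 of M^2 in place of 2M, because M \<ge> n - 1.\<close>

lemma Ak_quadratic:
  assumes "\<sigma> > 0" "m \<ge> 2" "\<And>i. i < m \<Longrightarrow> q ^ i \<le> Bn" "Bn \<le> q ^ m" "k \<ge> m"
  shows "A k \<ge> (n - 1)\<^sup>2 * \<sigma> / ((4 * R)\<^sup>2 * n) * (real k - real m + n - 1)\<^sup>2"
  using \<open>k \<ge> m\<close>
proof (induction k rule: dec_induct)
  case base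
  have "(n - 1)\<^sup>2 * \<sigma> / ((4 * R)\<^sup>2 * n) * (n - 1)\<^sup>2 \<le> (n - 1)\<^sup>2 * \<sigma> / ((4 * R)\<^sup>2 * n) * n\<^sup>2"
    using n2 sigma by (intro mult_left_mono power_mono) auto
  also have "\<dots> = n * (n - 1)\<^sup>2 * \<sigma> / (2 * R)\<^sup>2 / 4"
    using n2 R by (simp add: field_simps power2_eq_square)
  also have "\<dots> \<le> n * (n - 1)\<^sup>2 * \<sigma> / (2 * R)\<^sup>2"
  proof -
    have "x / 4 \<le> x" if "x \<ge> 0" for x :: real using that by linarith
    then show ?thesis using n2 sigma by (meson divide_nonneg_nonneg less_imp_le mult_nonneg_nonneg order.trans zero_le_numeral zero_le_power2)
  qed
  also have "\<dots> = (n - 1) / (2 * R) * (n * (\<sigma> * (n - 1) / (2 * R)))"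
    by (simp add: power2_eq_square)
  also have "\<dots> \<le> (n - 1) / (2 * R) * q ^ m"
    using assms(4) Bn_ge_sigma n2 R by (intro mult_left_mono) auto
  also have "\<dots> = A m" using Ak_geometric[OF assms(2), OF assms(3)] by simp
  finally show ?case by simp
next
  case (step k)
  define M where "M = real k - real m + n - 1"
  have M: "M \<ge> n - 1" "M \<ge> 0" using step.hyps n2 by (auto simp: M_def)
  have "((n - 1) * \<sigma> * M / (4 * R))\<^sup>2 = n * \<sigma> * ((n - 1)\<^sup>2 * \<sigma> / ((4 * R)\<^sup>2 * n) * M\<^sup>2)"
    using n2 R by (simp add: field_simps power2_eq_square)
  also have "\<dots> \<le> n * \<sigma> * A k"
    using step.IH n2 sigma unfolding M_def by (intro mult_left_mono) auto
  also have "\<dots> \<le> n * (n + \<sigma> * A k)" using n2 by (simp add: algebra_simps)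
  finally have "(n - 1) * \<sigma> * M / (4 * R) \<le> sqrt (n * (n + \<sigma> * A k))" by (rule real_le_rsqrt)
  moreover have "a (Suc k) = sqrt (n * (n + \<sigma> * A k)) / (2 * R)"
    by (rule ak_sqrt_branch[OF assms(1,2) _ assms(4) step.hyps(1)]) (rule assms(3))
  ultimately have "(n - 1) * \<sigma> * M / (4 * R) / (2 * R) \<le> a (Suc k)"
    using R by (simp only: divide_right_mono)
  moreover have "(n - 1)\<^sup>2 * \<sigma> / ((4 * R)\<^sup>2 * n) * (2 * M + 1) \<le> (n - 1) * \<sigma> * M / (4 * R) / (2 * R)"
  proof -
    have "(n - 1) * (2 * M + 1) \<le> 2 * n * M" using M by (simp add: algebra_simps)
    then have "(n - 1) * \<sigma> / ((4 * R)\<^sup>2 * n) * ((n - 1) * (2 * M + 1)) \<le> (n - 1) * \<sigma> / ((4 * R)\<^sup>2 * n) * (2 * n * M)"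
      using n2 sigma by (intro mult_left_mono) auto
    also have "\<dots> = (n - 1) * \<sigma> * M / (4 * R) / (2 * R)"
      using n2 R by (simp add: field_simps power2_eq_square)
    finally show ?thesis by (simp add: power2_eq_square algebra_simps)
  qed
  moreover have "(real (Suc k) - real m + n - 1)\<^sup>2 = M\<^sup>2 + (2 * M + 1)"
    by (simp add: M_def power2_eq_square algebra_simps)
  ultimately show ?case
    using step.IH unfolding M_def[symmetric] by (simp add: Ak_Suc distrib_left)
qed

text \<open>The second branch never falls below n / (2R), whatever \<sigma> is, so the steps grow by
  the factor q at least up to that level and then stay above it.\<close>

lemma ak_Suc_ge: "k \<ge> 1 \<Longrightarrow> a (Suc k) \<ge> min (q ^ k) n / (2 * R)"
proof (induction k rule: dec_induct)
  case base
  have "a (Suc 1) = q / (2 * R)" using ak_2' by (simp add: numeral_2_eq_2)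
  moreover have "min (q ^ 1) n / (2 * R) \<le> q / (2 * R)"
    using R by (intro divide_right_mono) auto
  ultimately show ?case by (simp only:)
next
  case (step k)
  have "min (q ^ Suc k) n / (2 * R) \<le> q * (min (q ^ k) n / (2 * R))"
  proof -
    have "n \<le> q * n" using mult_right_mono[of 1 q n] q_gt_1 n2 by simp
    moreover have "min (p * t) n \<le> p * min t n" if "n \<le> p * n" for p t :: real
      using that by (auto simp: min_def)
    ultimately have "min (q ^ Suc k) n \<le> q * min (q ^ k) n"
      unfolding power_Suc by blast
    then have "min (q ^ Suc k) n / (2 * R) \<le> q * min (q ^ k) n / (2 * R)"
      using R by (intro divide_right_mono) auto
    then show ?thesis by (simp only: times_divide_eq_right)
  qed
  also have "\<dots> \<le> q * a (Suc k)" using step.IH q_gt_1 by (intro mult_left_mono) auto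
  finally have 1: "min (q ^ Suc k) n / (2 * R) \<le> q * a (Suc k)" .
  have "n \<le> sqrt (n * (n + \<sigma> * A (Suc k)))"
    using n2 sigma Ak_nonneg[of "Suc k"] by (intro real_le_rsqrt) (simp add: power2_eq_square)
  then have 2: "min (q ^ Suc k) n / (2 * R) \<le> sqrt (n * (n + \<sigma> * A (Suc k))) / (2 * R)"
    using R by (intro divide_right_mono) auto
  have "Suc k \<ge> 2" using step.hyps by simp
  from ak_Suc'[OF this] show ?case using 1 2 by (simp only: min.bounded_iff)
qed

lemma Ak_linear:
  assumes "m \<ge> 1" "\<And>i. i < m \<Longrightarrow> q ^ i \<le> n" "n \<le> q ^ m" "k \<ge> m"
  shows "A k \<ge> n * (real k - real m + n - 1) / (2 * R)"
  using \<open>k \<ge> m\<close>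
proof (induction k rule: dec_induct)
  case base
  have "A m = (n - 1) / (2 * R) * q ^ m"
    using assms(1) by (rule Ak_geometric') (use assms(2) Bn_ge_n in fastforce)
  also have "\<dots> \<ge> (n - 1) / (2 * R) * n"
    using assms(3) n2 R by (intro mult_left_mono) auto
  finally show ?case by (simp add: mult.commute)
next
  case (step k)
  have "q ^ m \<le> q ^ k" using step.hyps q_gt_1 by (intro power_increasing) auto
  then have "a (Suc k) \<ge> n / (2 * R)"
    using ak_Suc_ge[of k] step.hyps assms(1,3) by (simp add: min_absorb2)
  then show ?case using step.IH R by (simp add: Ak_Suc field_simps)
qed

text \<open>The denominator is ln q, so e is the exponent at which the powers of q first reach t; t
  = n gives K_0 and t = \<open>Bn\<close> gives k_0.\<close>

lemma ceiling_log_q: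
  assumes "t \<ge> n"
  defines "e \<equiv> \<lceil>ln t / (ln n - ln (n - 1))\<rceil>"
  shows "e \<ge> 1" "t \<le> q ^ nat e" "\<And>i. i < nat e \<Longrightarrow> q ^ i \<le> t"
proof -
  have lq: "ln n - ln (n - 1) = ln q" using n2 by (simp add: ln_div)
  have lq0: "ln q > 0" using q_gt_1 by (intro ln_gt_zero)
  have t0: "t > 0" using assms n2 by linarith
  have q0: "q > 0" using q_gt_1 by linarith
  have lt: "ln t > 0" using assms n2 by (intro ln_gt_zero) linarith
  have "ln t / ln q > 0" using lt lq0 by simp
  then show e1: "e \<ge> 1" unfolding e_def lq by simp
  have "ln t / ln q \<le> real (nat e)" using e1 le_of_int_ceiling[of "ln t / ln q"] unfolding e_def lq by simp
  then have "ln t \<le> real (nat e) * ln q" using lq0 by (simp add: pos_divide_le_eq)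
  also have "\<dots> = ln (q ^ nat e)" using q0 by (simp only: ln_realpow)
  finally show "t \<le> q ^ nat e" using t0 q0 by (simp only: ln_le_cancel_iff zero_less_power)
  fix i assume "i < nat e"
  then have "int i < e" by linarith
  then have "real i < ln t / ln q" unfolding e_def lq by (simp add: less_ceiling_iff)
  then have "real i * ln q \<le> ln t" using lq0 by (simp add: pos_less_divide_eq)
  moreover have "real i * ln q = ln (q ^ i)" using q0 by (simp only: ln_realpow)
  ultimately show "q ^ i \<le> t" using t0 q0 by (simp only: ln_le_cancel_iff zero_less_power)
qed

theorem Ak_lower_bound:
  assumes k: "k \<ge> 2"
  defines "K0 \<equiv> \<lceil>ln n / (ln n - ln (n - 1))\<rceil>" and "k0 \<equiv> \<lceil>ln Bn / (ln n - ln (n - 1))\<rceil>"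
  shows "A k \<ge> max (max
            ((n - 1) / (2 * R) * (1 + 1 / (n - 1)) ^ k * of_bool (int k \<le> k0))
            ((n - 1)\<^sup>2 * \<sigma> / ((4 * R)\<^sup>2 * n) * (real k - real_of_int k0 + n - 1)\<^sup>2 * of_bool (int k \<ge> k0)))
            (n * (real k - real_of_int K0 + n - 1) / (2 * R) * of_bool (int k \<ge> K0))"
proof -
  note c0 = ceiling_log_q[OF Bn_ge_n, folded k0_def]
  note C0 = ceiling_log_q[OF order_refl, folded K0_def]
  have 1: "(n - 1) / (2 * R) * (1 + 1 / (n - 1)) ^ k * of_bool (int k \<le> k0) \<le> A k"
  proof (cases "int k \<le> k0")
    case True
    have "A k = (n - 1) / (2 * R) * q ^ k"
      using k True by (intro Ak_geometric' c0(3)) auto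
    then show ?thesis using True by (simp add: q_eq)
  qed (simp add: Ak_nonneg)
  have 2: "(n - 1)\<^sup>2 * \<sigma> / ((4 * R)\<^sup>2 * n) * (real k - real_of_int k0 + n - 1)\<^sup>2
      * of_bool (int k \<ge> k0) \<le> A k"
  proof (cases "int k \<ge> k0 \<and> \<sigma> > 0")
    case True
    have "s > 0" using True n2 R by simp
    \<comment> \<open>The quadratic phase is stated from index 2 on. If k_0 were 1, then
      \<open>Bn\<close> \<le> q \<le> n, whereas \<sigma> > 0 makes \<open>Bn\<close> exceed
      n.\<close>
    have "nat k0 \<ge> 2"
    proof (rule ccontr)
      assume "\<not> 2 \<le> nat k0"
      then have "nat k0 = 1" using c0(1) by linarith
      then have "Bn \<le> q" using c0(2) by simp
      moreover have "q \<le> n" using n2 by (simp add: field_simps)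
      moreover have "sqrt (s\<^sup>2 + n\<^sup>2) \<ge> n" by (auto intro: real_le_rsqrt)
      ultimately show False using \<open>s > 0\<close> by linarith
    qed
    then show ?thesis
      using Ak_quadratic[of "nat k0" k] c0 True by auto
  next
    case False
    then show ?thesis using sigma Ak_nonneg[of k] by auto
  qed
  have 3: "n * (real k - real_of_int K0 + n - 1) / (2 * R) * of_bool (int k \<ge> K0) \<le> A k"
  proof (cases "int k \<ge> K0")
    case True
    then show ?thesis using Ak_linear[of "nat K0" k] C0 by auto
  qed (simp add: Ak_nonneg)
  show ?thesis using 1 2 3 by simp
qed

end

section \<open>Strongly convex closed functions\<close>

text \<open>Extended-real functions are handled as a domain with a real function on it, so that all
  estimates take place in the reals; \<open>ext_on\<close> restores the extended function to which
  \<open>argmin\<close> applies.\<close>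

definition ext_on :: "'a set \<Rightarrow> ('a \<Rightarrow> real) \<Rightarrow> 'a \<Rightarrow> ereal" where
  "ext_on D P x = (if x \<in> D then ereal (P x) else \<infinity>)"

text \<open>The set in the first conjunct is the strict superlevel set of \<open>ext_on D P\<close>,
  so its openness is lower semicontinuity of the extension, including at boundary points of
  D.\<close>

definition closed_strongly_convex :: "real \<Rightarrow> 'a::real_normed_vector set \<Rightarrow> ('a \<Rightarrow> real) \<Rightarrow> bool" where
  "closed_strongly_convex \<mu> D P \<longleftrightarrow> (\<forall>c. open {x. x \<in> D \<longrightarrow> c < P x}) \<and>
     (\<forall>x\<in>D. \<forall>y\<in>D. \<forall>\<alpha>. 0 < \<alpha> \<and> \<alpha> < 1 \<longrightarrow> (1 - \<alpha>) *\<^sub>R x + \<alpha> *\<^sub>R y \<in> D \<and>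
        P ((1 - \<alpha>) *\<^sub>R x + \<alpha> *\<^sub>R y) \<le> (1 - \<alpha>) * P x + \<alpha> * P y - \<mu> / 2 * \<alpha> * (1 - \<alpha>) * (norm (y - x))\<^sup>2)"

lemma closed_strongly_convexI:
  assumes "\<And>c. open {x. x \<in> D \<longrightarrow> c < P x}"
    and "\<And>x y \<alpha>. x \<in> D \<Longrightarrow> y \<in> D \<Longrightarrow> 0 < \<alpha> \<Longrightarrow> \<alpha> < 1 \<Longrightarrow> (1 - \<alpha>) *\<^sub>R x + \<alpha> *\<^sub>R y \<in> D"
    and "\<And>x y \<alpha>. x \<in> D \<Longrightarrow> y \<in> D \<Longrightarrow> 0 < \<alpha> \<Longrightarrow> \<alpha> < 1 \<Longrightarrow>
       P ((1 - \<alpha>) *\<^sub>R x + \<alpha> *\<^sub>R y) \<le> (1 - \<alpha>) * P x + \<alpha> * P y - \<mu> / 2 * \<alpha> * (1 - \<alpha>) * (norm (y - x))\<^sup>2"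
  shows "closed_strongly_convex \<mu> D P"
  using assms unfolding closed_strongly_convex_def by blast

lemma closed_strongly_convexD:
  assumes "closed_strongly_convex \<mu> D P"
  shows "open {x. x \<in> D \<longrightarrow> c < P x}"
    and "x \<in> D \<Longrightarrow> y \<in> D \<Longrightarrow> 0 < \<alpha> \<Longrightarrow> \<alpha> < 1 \<Longrightarrow> (1 - \<alpha>) *\<^sub>R x + \<alpha> *\<^sub>R y \<in> D"
    and "x \<in> D \<Longrightarrow> y \<in> D \<Longrightarrow> 0 < \<alpha> \<Longrightarrow> \<alpha> < 1 \<Longrightarrow>
       P ((1 - \<alpha>) *\<^sub>R x + \<alpha> *\<^sub>R y) \<le> (1 - \<alpha>) * P x + \<alpha> * P y - \<mu> / 2 * \<alpha> * (1 - \<alpha>) * (norm (y - x))\<^sup>2"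
  using assms unfolding closed_strongly_convex_def by blast+

lemma closed_strongly_convex_add:
  assumes P: "closed_strongly_convex \<mu> D P" and Q: "closed_strongly_convex \<nu> E Q"
  shows "closed_strongly_convex (\<mu> + \<nu>) (D \<inter> E) (\<lambda>x. P x + Q x)"
proof (rule closed_strongly_convexI)
  fix c :: real
  \<comment> \<open>A threshold r between the two summands writes the superlevel set of the sum as a
    union of intersections of open sets; off a domain the infinite value leaves r free on that
    side.\<close>
  have "\<exists>r. (x \<in> D \<longrightarrow> r < P x) \<and> (x \<in> E \<longrightarrow> c - r < Q x)"
    if "x \<in> D \<inter> E \<longrightarrow> c < P x + Q x" for x
  proof (cases "x \<in> D")
    case True
    show ?thesis
    proof (cases "x \<in> E")
      case True
      then have "c - Q x < P x" using that \<open>x \<in> D\<close> by auto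
      then obtain r where "c - Q x < r" "r < P x" using dense by blast
      then show ?thesis by (intro exI[of _ r]) auto
    next
      case False
      then show ?thesis by (intro exI[of _ "P x - 1"]) auto
    qed
  next
    case False
    then show ?thesis by (intro exI[of _ "c - Q x + 1"]) auto
  qed
  then have "{x. x \<in> D \<inter> E \<longrightarrow> c < P x + Q x} =
      (\<Union>r. {x. x \<in> D \<longrightarrow> r < P x} \<inter> {x. x \<in> E \<longrightarrow> c - r < Q x})"
    by fastforce
  then show "open {x. x \<in> D \<inter> E \<longrightarrow> c < P x + Q x}"
    using closed_strongly_convexD(1)[OF P] closed_strongly_convexD(1)[OF Q]
    by (simp only:) (intro open_UN ballI open_Int; simp)
next
  fix x y \<alpha> assume xy: "x \<in> D \<inter> E" "y \<in> D \<inter> E" and \<alpha>: "0 < (\<alpha>::real)" "\<alpha> < 1"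
  show "(1 - \<alpha>) *\<^sub>R x + \<alpha> *\<^sub>R y \<in> D \<inter> E"
    using closed_strongly_convexD(2)[OF P] closed_strongly_convexD(2)[OF Q] xy \<alpha> by auto
  show "P ((1 - \<alpha>) *\<^sub>R x + \<alpha> *\<^sub>R y) + Q ((1 - \<alpha>) *\<^sub>R x + \<alpha> *\<^sub>R y) \<le>
      (1 - \<alpha>) * (P x + Q x) + \<alpha> * (P y + Q y) - (\<mu> + \<nu>) / 2 * \<alpha> * (1 - \<alpha>) * (norm (y - x))\<^sup>2"
    using closed_strongly_convexD(3)[OF P, of x y \<alpha>] closed_strongly_convexD(3)[OF Q, of x y \<alpha>] xy \<alpha>
    by (simp add: algebra_simps add_divide_distrib)
qed

lemma closed_strongly_convex_scale:
  assumes P: "closed_strongly_convex \<mu> D P" and "c > 0"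
  shows "closed_strongly_convex (c * \<mu>) D (\<lambda>x. c * P x)"
proof (rule closed_strongly_convexI)
  fix d :: real
  have "{x. x \<in> D \<longrightarrow> d < c * P x} = {x. x \<in> D \<longrightarrow> d / c < P x}"
    using \<open>c > 0\<close> by (simp add: pos_divide_less_eq mult.commute)
  then show "open {x. x \<in> D \<longrightarrow> d < c * P x}" using closed_strongly_convexD(1)[OF P] by simp
next
  fix x y \<alpha> assume h: "x \<in> D" "y \<in> D" "0 < (\<alpha>::real)" "\<alpha> < 1"
  show "(1 - \<alpha>) *\<^sub>R x + \<alpha> *\<^sub>R y \<in> D" using closed_strongly_convexD(2)[OF P h] .
  show "c * P ((1 - \<alpha>) *\<^sub>R x + \<alpha> *\<^sub>R y) \<le>
      (1 - \<alpha>) * (c * P x) + \<alpha> * (c * P y) - c * \<mu> / 2 * \<alpha> * (1 - \<alpha>) * (norm (y - x))\<^sup>2"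
    using mult_left_mono[OF closed_strongly_convexD(3)[OF P h], of c] \<open>c > 0\<close>
    by (simp add: algebra_simps)
qed

lemma closed_strongly_convex_continuous:
  assumes "continuous_on UNIV P"
    and "\<And>x y \<alpha>. 0 < \<alpha> \<Longrightarrow> \<alpha> < 1 \<Longrightarrow>
       P ((1 - \<alpha>) *\<^sub>R x + \<alpha> *\<^sub>R y) \<le> (1 - \<alpha>) * P x + \<alpha> * P y - \<mu> / 2 * \<alpha> * (1 - \<alpha>) * (norm (y - x))\<^sup>2"
  shows "closed_strongly_convex \<mu> UNIV P"
  using assms by (intro closed_strongly_convexI) (auto intro!: open_Collect_less)

lemma closed_strongly_convex_affine:
  "closed_strongly_convex 0 UNIV (\<lambda>x::'a::real_inner. x \<bullet> w + c)"
  by (rule closed_strongly_convex_continuous)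
    (auto intro!: continuous_intros simp: inner_simps algebra_simps)

lemma closed_strongly_convex_sq_norm:
  "closed_strongly_convex \<mu> UNIV (\<lambda>x::'a::real_inner. \<mu> / 2 * (norm (x - x0))\<^sup>2)"
proof (rule closed_strongly_convex_continuous)
  fix x y :: 'a and \<alpha> :: real
  have eq: "(norm ((1 - \<alpha>) *\<^sub>R x + \<alpha> *\<^sub>R y - x0))\<^sup>2
      = (1 - \<alpha>) * (norm (x - x0))\<^sup>2 + \<alpha> * (norm (y - x0))\<^sup>2 - \<alpha> * (1 - \<alpha>) * (norm (y - x))\<^sup>2"
    unfolding power2_norm_eq_inner by (simp add: inner_simps inner_commute algebra_simps)
  show "\<mu> / 2 * (norm ((1 - \<alpha>) *\<^sub>R x + \<alpha> *\<^sub>R y - x0))\<^sup>2 \<le> (1 - \<alpha>) * (\<mu> / 2 * (norm (x - x0))\<^sup>2) +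
      \<alpha> * (\<mu> / 2 * (norm (y - x0))\<^sup>2) - \<mu> / 2 * \<alpha> * (1 - \<alpha>) * (norm (y - x))\<^sup>2"
    by (simp only: eq) (simp add: field_simps)
qed (intro continuous_intros)

lemma closed_strongly_convex_coordinate:
  fixes G :: "real \<Rightarrow> real" and j :: "'n::finite"
  assumes G: "closed_strongly_convex 0 E G"
  shows "closed_strongly_convex 0 {y. y $ j \<in> E} (\<lambda>y. G (y $ j))"
proof (rule closed_strongly_convexI)
  fix c
  have "open ((\<lambda>y::real^'n. y $ j) -` {t. t \<in> E \<longrightarrow> c < G t})"
    by (intro open_vimage closed_strongly_convexD(1)[OF G] continuous_intros)
  then show "open {y::real^'n. y \<in> {y. y $ j \<in> E} \<longrightarrow> c < G (y $ j)}" by (simp add: vimage_def)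
qed (use closed_strongly_convexD[OF G] in auto)

lemma closed_strongly_convex_sum:
  assumes "finite I" "\<And>i. i \<in> I \<Longrightarrow> closed_strongly_convex 0 (D i) (P i)"
  shows "closed_strongly_convex 0 (\<Inter>i\<in>I. D i) (\<lambda>x. \<Sum>i\<in>I. P i x)"
  using assms
proof (induction I rule: finite_induct)
  case empty
  show ?case by (simp add: closed_strongly_convex_continuous)
next
  case (insert i I)
  then show ?case
    using closed_strongly_convex_add[of 0 "D i" "P i" 0 "\<Inter>i\<in>I. D i" "\<lambda>x. \<Sum>i\<in>I. P i x"] by simp
qed

text \<open>Without a minimiser, the open sets where P exceeds P y would cover S, but the point of
  least value among the centres of a finite subcover lies in none of its sets.\<close>

lemma lsc_attains_min_compact:
  fixes D :: "'a::t2_space set"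
  assumes "\<And>c. open {x. x \<in> D \<longrightarrow> c < (P x :: real)}" and "compact S" and "S \<inter> D \<noteq> {}"
  shows "\<exists>x\<in>S \<inter> D. \<forall>y\<in>S \<inter> D. P x \<le> P y"
proof (rule ccontr)
  assume neg: "\<not> ?thesis"
  let ?U = "\<lambda>y. {x. x \<in> D \<longrightarrow> P y < P x}"
  have "S \<subseteq> (\<Union>y\<in>S \<inter> D. ?U y)"
  proof
    fix x assume "x \<in> S"
    show "x \<in> (\<Union>y\<in>S \<inter> D. ?U y)"
    proof (cases "x \<in> D")
      case True
      then obtain y where "y \<in> S \<inter> D" "P y < P x" using neg \<open>x \<in> S\<close> by (meson IntI not_le)
      then show ?thesis by blast
    qed (use assms(3) in auto)
  qed
  then obtain T where T: "T \<subseteq> S \<inter> D" "finite T" "S \<subseteq> (\<Union>y\<in>T. ?U y)"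
    by (rule compactE_image[OF assms(2) assms(1)])
  have "T \<noteq> {}" using T(3) assms(3) by auto
  then obtain t where t: "t \<in> T" "\<forall>y\<in>T. P t \<le> P y"
    using T(2) ex_min_if_finite[of "P ` T"] by (force simp: not_less)
  then obtain y where "y \<in> T" "t \<in> ?U y" using T by blast
  then show False using t T(1) by force
qed

text \<open>Strong convexity along the segment from a fixed point \<open>z\<close> of the domain turns a lower bound on
  the unit ball around \<open>z\<close> into superlinear growth, so minimisation reduces to a compact ball.\<close>

lemma closed_strongly_convex_has_min:
  fixes D :: "'a::euclidean_space set"
  assumes P: "closed_strongly_convex \<mu> D P" and \<mu>: "\<mu> > 0" and z: "z \<in> D"
  shows "\<exists>x\<in>D. \<forall>y\<in>D. P x \<le> P y"
proof -
  have ne: "cball z r \<inter> D \<noteq> {}" if "r \<ge> 0" for r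
    using z that by (metis IntI centre_in_cball empty_iff)
  obtain w where w: "w \<in> cball z 1 \<inter> D" "\<forall>y\<in>cball z 1 \<inter> D. P w \<le> P y"
    using lsc_attains_min_compact[OF closed_strongly_convexD(1)[OF P] compact_cball ne, of 1] by auto
  \<comment> \<open>At distance r > \<rho> the growth \<mu>/2 * (r - 1) exceeds P z - P w, the
    largest drop of P below P z on the unit ball, so points outside this radius have values of at
    least P z.\<close>
  define \<rho> where "\<rho> = 1 + 2 * (P z - P w) / \<mu>"
  have wz: "P w \<le> P z" using w(2) z by auto
  then have \<rho>: "\<rho> \<ge> 1" using \<mu> by (simp add: \<rho>_def)
  obtain x where x: "x \<in> cball z \<rho> \<inter> D" "\<forall>y\<in>cball z \<rho> \<inter> D. P x \<le> P y"
    using lsc_attains_min_compact[OF closed_strongly_convexD(1)[OF P] compact_cball ne, of \<rho>] \<rho> by auto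
  have "P x \<le> P y" if y: "y \<in> D" for y
  proof (cases "y \<in> cball z \<rho>")
    case True
    then show ?thesis using x y by auto
  next
    case False
    define r where "r = norm (y - z)"
    have r: "r > \<rho>" using False by (simp add: r_def dist_norm norm_minus_commute)
    then have r1: "r > 1" using \<rho> by simp
    define p where "p = (1 - 1 / r) *\<^sub>R z + (1 / r) *\<^sub>R y"
    have a: "0 < 1 / r" "1 / r < 1" using r1 by auto
    have pD: "p \<in> D" unfolding p_def by (rule closed_strongly_convexD(2)[OF P z y a])
    have "p - z = (1 / r) *\<^sub>R (y - z)" by (simp add: p_def algebra_simps)
    then have "norm (p - z) = 1" using r1 by (auto simp: r_def)
    then have "p \<in> cball z 1" by (simp add: dist_norm norm_minus_commute)
    then have "P w \<le> P p" using w pD by auto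
    also have "P p \<le> (1 - 1 / r) * P z + 1 / r * P y - \<mu> / 2 * (1 / r) * (1 - 1 / r) * r\<^sup>2"
      using closed_strongly_convexD(3)[OF P z y a] unfolding p_def r_def by simp
    finally have "r * P w \<le> r * ((1 - 1 / r) * P z + 1 / r * P y - \<mu> / 2 * (1 / r) * (1 - 1 / r) * r\<^sup>2)"
      using r1 by (intro mult_left_mono) auto
    also have "\<dots> = (r - 1) * P z + P y - r * (\<mu> / 2 * (r - 1))"
      using r1 by (simp add: field_simps power2_eq_square)
    finally have 1: "P y \<ge> P z + r * (\<mu> / 2 * (r - 1) - (P z - P w))" by (simp add: algebra_simps)
    have "\<mu> / 2 * (r - 1) \<ge> \<mu> / 2 * (\<rho> - 1)" using r \<mu> by (intro mult_left_mono) auto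
    moreover have "\<mu> / 2 * (\<rho> - 1) = P z - P w" using \<mu> by (simp add: \<rho>_def)
    ultimately have "r * (\<mu> / 2 * (r - 1) - (P z - P w)) \<ge> 0"
      using r1 by (intro mult_nonneg_nonneg) auto
    moreover have "P x \<le> P z" using x z \<rho> by auto
    ultimately show ?thesis using 1 by linarith
  qed
  then show ?thesis using x by auto
qed

text \<open>Minimality along the segment from x to y, divided by \<alpha>, gives the claim with an
  extra factor 1 - \<alpha>; then \<alpha> tends to 0.\<close>

lemma closed_strongly_convex_min_growth:
  assumes P: "closed_strongly_convex \<mu> D P" and x: "x \<in> D" "\<And>y. y \<in> D \<Longrightarrow> P x \<le> P y" and y: "y \<in> D"
  shows "P y \<ge> P x + \<mu> / 2 * (norm (y - x))\<^sup>2"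
proof -
  let ?c = "\<mu> / 2 * (norm (y - x))\<^sup>2"
  have "(1 - \<alpha>) * ?c \<le> P y - P x" if \<alpha>: "0 < \<alpha>" "\<alpha> < 1" for \<alpha>
  proof -
    have "P x \<le> (1 - \<alpha>) * P x + \<alpha> * P y - \<mu> / 2 * \<alpha> * (1 - \<alpha>) * (norm (y - x))\<^sup>2"
      using x(2)[OF closed_strongly_convexD(2)[OF P x(1) y \<alpha>]] closed_strongly_convexD(3)[OF P x(1) y \<alpha>]
      by linarith
    then have "\<alpha> * ((1 - \<alpha>) * ?c) \<le> \<alpha> * (P y - P x)" by (simp add: algebra_simps)
    then show ?thesis using \<alpha> by simp
  qed
  then have "eventually (\<lambda>\<alpha>. (1 - \<alpha>) * ?c \<le> P y - P x) (at_right 0)"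
    unfolding eventually_at_right_field by (intro exI[of _ 1]) auto
  moreover have "((\<lambda>\<alpha>. (1 - \<alpha>) * ?c) \<longlongrightarrow> (1 - 0) * ?c) (at_right 0)"
    by (intro tendsto_intros)
  ultimately have "(1 - 0) * ?c \<le> P y - P x"
    by (intro tendsto_upperbound) auto
  then show ?thesis by simp
qed

lemma argmin_ext_on:
  fixes D :: "'a::euclidean_space set"
  assumes P: "closed_strongly_convex \<mu> D P" and \<mu>: "\<mu> > 0" and z: "z \<in> D"
  shows "argmin (ext_on D P) \<in> D" and "\<And>y. y \<in> D \<Longrightarrow> P (argmin (ext_on D P)) \<le> P y"
proof -
  obtain x where "x \<in> D" "\<forall>y\<in>D. P x \<le> P y"
    using closed_strongly_convex_has_min[OF assms] by auto
  then have "\<forall>y. ext_on D P x \<le> ext_on D P y" by (auto simp: ext_on_def)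
  then have min: "\<forall>y. ext_on D P (argmin (ext_on D P)) \<le> ext_on D P y"
    unfolding argmin_def by (rule someI)
  have "ext_on D P (argmin (ext_on D P)) \<le> ext_on D P z" using min by blast
  then show *: "argmin (ext_on D P) \<in> D" using z by (auto simp: ext_on_def split: if_splits)
  show "P (argmin (ext_on D P)) \<le> P y" if "y \<in> D" for y
    using min[rule_format, of y] that * by (simp add: ext_on_def)
qed

section \<open>From extended-real functions to domains with real functions\<close>

lemma ext_on_edom:
  assumes "proper_fun f"
  shows "f = ext_on (edom f) (\<lambda>x. real_of_ereal (f x))"
proof
  fix x
  show "f x = ext_on (edom f) (\<lambda>x. real_of_ereal (f x)) x"
    using assms by (cases "f x") (auto simp: proper_fun_def ext_on_def edom_def)
qed

lemma closed_strongly_convex_of_ereal: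
  fixes f :: "'a::real_normed_vector \<Rightarrow> ereal"
  assumes f: "proper_fun f" "lsc_fun f" "strongly_convex_fun \<mu> f"
  shows "closed_strongly_convex \<mu> (edom f) (\<lambda>x. real_of_ereal (f x))"
proof -
  define P where "P = (\<lambda>x. real_of_ereal (f x))"
  have fP: "f x = ereal (P x)" if "x \<in> edom f" for x
    using ext_on_edom[OF f(1)] that by (metis P_def ext_on_def)
  have fi: "f x = \<infinity>" if "x \<notin> edom f" for x using that by (simp add: edom_def)
  have "closed_strongly_convex \<mu> (edom f) P"
  proof (rule closed_strongly_convexI)
    fix c :: real
    have "{x. x \<in> edom f \<longrightarrow> c < P x} = {x. ereal c < f x}"
    proof (rule Collect_cong)
      show "(x \<in> edom f \<longrightarrow> c < P x) = (ereal c < f x)" for x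
        using fP[of x] fi[of x] by (cases "x \<in> edom f") auto
    qed
    moreover have "open {x. ereal c < f x}"
      unfolding open_subopen[of "{x. ereal c < f x}"]
    proof clarify
      fix x assume x: "ereal c < f x"
      then have "ereal c < Liminf (at x) f" using f(2) unfolding lsc_fun_def by (metis order.strict_trans2)
      then have "eventually (\<lambda>y. ereal c < f y) (at x)" by (rule less_LiminfD)
      then obtain T where T: "open T" "x \<in> T" "\<And>y. y \<in> T \<Longrightarrow> y \<noteq> x \<Longrightarrow> ereal c < f y"
        unfolding eventually_at_topological by blast
      \<comment> \<open>The filter \<open>at x\<close> says nothing about x itself, where the
        inequality is the assumption.\<close>
      show "\<exists>T. open T \<and> x \<in> T \<and> T \<subseteq> {x. ereal c < f x}"
      proof (intro exI[of _ T] conjI subsetI CollectI T(1,2))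
        show "ereal c < f y" if "y \<in> T" for y using T(3)[OF that] x by (cases "y = x") auto
      qed
    qed
    ultimately show "open {x. x \<in> edom f \<longrightarrow> c < P x}" by simp
  next
    fix x y and \<alpha> :: real assume h: "x \<in> edom f" "y \<in> edom f" "0 < \<alpha>" "\<alpha> < 1"
    let ?w = "(1 - \<alpha>) *\<^sub>R x + \<alpha> *\<^sub>R y"
    have le: "f ?w \<le> ereal ((1 - \<alpha>) * P x + \<alpha> * P y - \<mu> / 2 * \<alpha> * (1 - \<alpha>) * (norm (y - x))\<^sup>2)"
    proof -
      have "f ?w \<le> ereal (1 - \<alpha>) * f x + ereal \<alpha> * f y
          - ereal (\<mu> / 2 * \<alpha> * (1 - \<alpha>) * (norm (y - x))\<^sup>2)"
        using f(3) h(3,4) unfolding strongly_convex_fun_def by blast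
      then show ?thesis by (simp add: fP[OF h(1)] fP[OF h(2)])
    qed
    then show *: "?w \<in> edom f" by (auto simp: edom_def intro: le_less_trans)
    show "P ?w \<le> (1 - \<alpha>) * P x + \<alpha> * P y - \<mu> / 2 * \<alpha> * (1 - \<alpha>) * (norm (y - x))\<^sup>2"
      using le unfolding fP[OF *] by simp
  qed
  then show ?thesis by (simp add: P_def)
qed

lemma strongly_convex_fun_0: "convex_fun f \<Longrightarrow> strongly_convex_fun 0 f"
  by (simp add: convex_fun_def strongly_convex_fun_def zero_ereal_def[symmetric])

lemma closed_strongly_convex_convex_on:
  assumes "closed_strongly_convex \<mu> D P" "\<mu> \<ge> 0"
  shows "convex_on D P"
proof -
  have "convex D"
    unfolding convex_alt using closed_strongly_convexD(2)[OF assms(1)]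
    by (metis add.right_neutral add_0 diff_zero diff_self less_le scaleR_one scaleR_zero_left)
  moreover have "P ((1 - t) *\<^sub>R x + t *\<^sub>R y) \<le> (1 - t) * P x + t * P y"
    if "0 < t" "t < 1" "x \<in> D" "y \<in> D" for t x y
  proof -
    have "\<mu> / 2 * t * (1 - t) * (norm (y - x))\<^sup>2 \<ge> 0" using that assms(2) by simp
    then show ?thesis using closed_strongly_convexD(3)[OF assms(1) that(3,4,1,2)] by linarith
  qed
  ultimately show ?thesis by (intro convex_onI) auto
qed

section \<open>The algorithm\<close>

lemma inner_Bmat: "Bmat b x \<bullet> y = (\<Sum>i\<in>UNIV. (b i \<bullet> x) * y $ i) / real CARD('n)"
  for b :: "'n::finite \<Rightarrow> real^'d"
  by (simp add: Bmat_def inner_vec_def[where 'b = 'n] sum_divide_distrib)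

lemma inner_BT: "BT b y \<bullet> x = Bmat b x \<bullet> y"
  for b :: "'n::finite \<Rightarrow> real^'d"
  by (simp add: inner_Bmat BT_def inner_sum_left mult.commute sum_divide_distrib)

lemma Bmat_diff: "Bmat b (x - y) = Bmat b x - Bmat b y"
  and Bmat_scaleR: "Bmat b (c *\<^sub>R x) = c *\<^sub>R Bmat b x"
  by (simp_all add: Bmat_def vec_eq_iff inner_diff_right diff_divide_distrib)

lemma norm_sq_vec: "(norm (y :: real^'n))\<^sup>2 = (\<Sum>i\<in>UNIV. (y $ i)\<^sup>2)"
  unfolding power2_norm_eq_inner inner_vec_def by (simp add: power2_eq_square)

text \<open>The origin of the 2R in the step sizes: the bound on t cancels R and leaves half the
  product of sqrt n * y and sqrt c * x, which splits into two quarters of squares.\<close>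

lemma weighted_AM_GM:
  fixes x y c n R t :: real
  assumes "0 \<le> x" "0 \<le> y" "0 \<le> c" "0 \<le> n" "0 < R" "t \<le> sqrt (n * c) / (2 * R)"
  shows "t * (R * x * y) \<le> n / 4 * y\<^sup>2 + c / 4 * x\<^sup>2"
proof -
  have "t * (R * x * y) \<le> sqrt (n * c) / (2 * R) * (R * x * y)"
    using assms by (intro mult_right_mono) auto
  also have "\<dots> = (sqrt n * y) * (sqrt c * x) / 2"
    using assms by (simp add: real_sqrt_mult)
  also have "\<dots> \<le> ((sqrt n * y)\<^sup>2 + (sqrt c * x)\<^sup>2) / 4"
  proof -
    have "p * q / 2 \<le> (p\<^sup>2 + q\<^sup>2) / 4" for p q :: real using sum_squares_bound[of p q] by simp
    then show ?thesis .
  qed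
  also have "\<dots> = n / 4 * y\<^sup>2 + c / 4 * x\<^sup>2"
    using assms by (simp add: power_mult_distrib add_divide_distrib)
  finally show ?thesis .
qed

lemma sum_coordinate_change:
  fixes y y' :: "real^'n" and h :: "'n \<Rightarrow> real \<Rightarrow> real"
  assumes "\<forall>i. i \<noteq> j \<longrightarrow> y' $ i = y $ i"
  shows "(\<Sum>i\<in>UNIV. h i (y' $ i)) - (\<Sum>i\<in>UNIV. h i (y $ i)) = h j (y' $ j) - h j (y $ j)"
proof -
  have "(\<Sum>i\<in>UNIV. h i (y' $ i)) - (\<Sum>i\<in>UNIV. h i (y $ i)) = (\<Sum>i\<in>UNIV. h i (y' $ i) - h i (y $ i))"
    by (simp add: sum_subtractf)
  also have "\<dots> = (\<Sum>i\<in>UNIV. if i = j then h j (y' $ j) - h j (y $ j) else 0)"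
    using assms by (intro sum.cong) auto
  finally show ?thesis by simp
qed

text \<open>The martingale property as a finite Fubini argument: index i enters only through the
  second argument of f, so summing over it first gives zero.\<close>

lemma sum_PiE_centered:
  fixes f :: "('i \<Rightarrow> 'n::finite) \<Rightarrow> 'n \<Rightarrow> real"
  assumes "finite I" "i \<in> I" "\<And>js c j. f (js(i := c)) j = f js j" "\<And>js. (\<Sum>j\<in>UNIV. f js j) = 0"
  shows "(\<Sum>js\<in>PiE I (\<lambda>_. UNIV). f js (js i)) = 0"
proof -
  define J where "J = I - {i}"
  have I: "I = insert i J" "i \<notin> J" using assms(2) by (auto simp: J_def)
  let ?c = "\<lambda>(y, js). js(i := y)" and ?S = "(UNIV :: 'n set) \<times> PiE J (\<lambda>_. UNIV :: 'n set)"
  have "(\<Sum>js\<in>PiE I (\<lambda>_. UNIV). f js (js i)) = (\<Sum>js\<in>?c ` ?S. f js (js i))"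
    unfolding I(1) PiE_insert_eq ..
  also have "\<dots> = (\<Sum>p\<in>?S. f (?c p) (?c p i))"
    using sum.reindex[OF inj_combinator[OF I(2), of "\<lambda>_. UNIV"]] by simp
  also have "\<dots> = (\<Sum>(y, js)\<in>?S. f js y)"
    by (intro sum.cong) (auto simp: assms(3))
  also have "\<dots> = (\<Sum>y\<in>UNIV. \<Sum>js\<in>PiE J (\<lambda>_. UNIV). f js y)"
    by (simp add: sum.cartesian_product)
  also have "\<dots> = (\<Sum>js\<in>PiE J (\<lambda>_. UNIV). \<Sum>y\<in>UNIV. f js y)" by (rule sum.swap)
  finally show ?thesis by (simp add: assms(4))
qed

lemma convex_weighted_mean:
  assumes f: "convex_on D f" and "finite I" and c: "\<And>i. i \<in> I \<Longrightarrow> c i \<ge> 0" "(\<Sum>i\<in>I. c i) = C" "C > 0"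
    and z: "\<And>i. i \<in> I \<Longrightarrow> z i \<in> D"
  shows "(1 / C) *\<^sub>R (\<Sum>i\<in>I. c i *\<^sub>R z i) \<in> D"
    and "C * f ((1 / C) *\<^sub>R (\<Sum>i\<in>I. c i *\<^sub>R z i)) \<le> (\<Sum>i\<in>I. c i * f (z i))"
proof -
  have eq: "(1 / C) *\<^sub>R (\<Sum>i\<in>I. c i *\<^sub>R z i) = (\<Sum>i\<in>I. (c i / C) *\<^sub>R z i)"
    by (simp add: scaleR_sum_right)
  have w: "(\<Sum>i\<in>I. c i / C) = 1" "\<And>i. i \<in> I \<Longrightarrow> c i / C \<ge> 0"
    using c by (simp_all add: sum_divide_distrib[symmetric])
  have I: "I \<noteq> {}" using c by auto
  show "(1 / C) *\<^sub>R (\<Sum>i\<in>I. c i *\<^sub>R z i) \<in> D"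
    unfolding eq using f w z \<open>finite I\<close> by (intro convex_sum) (auto simp: convex_on_def)
  have "f (\<Sum>i\<in>I. (c i / C) *\<^sub>R z i) \<le> (\<Sum>i\<in>I. c i / C * f (z i))"
    using f w z \<open>finite I\<close> I by (intro convex_on_sum) auto
  then have "C * f (\<Sum>i\<in>I. (c i / C) *\<^sub>R z i) \<le> C * (\<Sum>i\<in>I. c i / C * f (z i))"
    using c by (intro mult_left_mono) auto
  also have "\<dots> = (\<Sum>i\<in>I. c i * f (z i))" using c by (simp add: sum_distrib_left)
  finally show "C * f ((1 / C) *\<^sub>R (\<Sum>i\<in>I. c i *\<^sub>R z i)) \<le> (\<Sum>i\<in>I. c i * f (z i))"
    unfolding eq .
qed

lemma vrpda_cong:
  "(\<And>i. 2 \<le> i \<Longrightarrow> i \<le> k \<Longrightarrow> js i = js' i) \<Longrightarrow>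
    vrpda b g ell R \<sigma> x0 y0 u v js k = vrpda b g ell R \<sigma> x0 y0 u v js' k"
proof (induction k)
  case (Suc k)
  have IH: "vrpda b g ell R \<sigma> x0 y0 u v js k = vrpda b g ell R \<sigma> x0 y0 u v js' k"
    using Suc by simp
  show ?case
  proof (cases k)
    case (Suc m)
    have "js (Suc (Suc m)) = js' (Suc (Suc m))" using Suc.prems Suc by simp
    then show ?thesis using IH unfolding Suc vrpda.simps(3) by simp
  qed simp
qed simp

locale vrpda_problem =
  fixes b :: "'n::finite \<Rightarrow> real^'d" and g :: "'n \<Rightarrow> real \<Rightarrow> ereal"
    and ell :: "real^'d \<Rightarrow> ereal" and R \<sigma> :: real
    and x0 u :: "real^'d" and y0 v :: "real^'n" and N :: real
  assumes N_def: "N = real CARD('n)" and n2: "CARD('n) \<ge> 2"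
    and R: "R > 0" and bnorm: "\<And>i. norm (b i) \<le> R"
    and g: "\<And>i. proper_fun (g i)" "\<And>i. lsc_fun (g i)" "\<And>i. convex_fun (g i)"
    and ell: "proper_fun ell" "lsc_fun ell" and sigma: "\<sigma> \<ge> 0" "strongly_convex_fun \<sigma> ell"
    and uv: "u \<in> edom ell" "v \<in> edom (gstar g)"
begin

lemma N2: "N \<ge> 2" using n2 N_def by linarith

sublocale st: step_sizes N R \<sigma>
  using N2 R sigma by unfold_locales auto

abbreviation "a \<equiv> ak N R \<sigma>"
abbreviation "A \<equiv> Ak N R \<sigma>"
abbreviation "X \<equiv> xk b g ell R \<sigma> x0 y0 u v"
abbreviation "Y \<equiv> yk b g ell R \<sigma> x0 y0 u v"
abbreviation "DL \<equiv> edom ell"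
abbreviation "DG \<equiv> edom (gstar g)"

section \<open>Estimate sequences in real form\<close>

definition "lr x = real_of_ereal (ell x)"
definition "G i t = real_of_ereal (g i t)"
definition "Gs y = (\<Sum>i\<in>UNIV. G i (y $ i)) / N"

text \<open>The extrapolated point used in iteration k, determined by the indices before j_k; for k
  = 2 the index k - 2 refers to x_0.\<close>

definition "Xb js k = X js (k - 1) + (a (k - 1) / a k) *\<^sub>R (X js (k - 1) - X js (k - 2))"

text \<open>The vector paired with x in iteration k. For k \<ge> 2 it is B^T applied to y_{k-1} + n
  (y_k - y_{k-1}), as y_k and y_{k-1} differ only at j_k; the first iteration treats all coordinates
  at once.\<close>

definition "\<zeta> js k = (if k = 1 then BT b (Y js 1)
  else BT b (Y js (k - 1)) + (Y js k $ js k - Y js (k - 1) $ js k) *\<^sub>R b (js k))"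

text \<open>The estimate sequences \<open>\<psi>\<^sub>k\<close> and \<open>\<phi>\<^sub>k\<close>, with an arbitrary comparison point in place of
  \<open>v\<close> and \<open>u\<close>: this changes them only by a constant, so the iterates minimise all of them.\<close>

definition "Psi yc js k y = N / 2 * (norm (y - y0))\<^sup>2 + a 1 * (- (Bmat b x0 \<bullet> (y - yc)) + Gs y)
  + (\<Sum>i=2..k. a i * (- (b (js i) \<bullet> Xb js i) * (y $ js i - yc $ js i) + G (js i) (y $ js i)))"

definition "Phi xc js k x = N / 2 * (norm (x - x0))\<^sup>2 + (\<Sum>i=1..k. a i * ((x - xc) \<bullet> \<zeta> js i + lr x))"

lemma ell_eq: "x \<in> DL \<Longrightarrow> ell x = ereal (lr x)"
  using ext_on_edom[OF ell(1)] by (metis lr_def ext_on_def)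

lemma csc_ell: "closed_strongly_convex \<sigma> DL lr"
  using closed_strongly_convex_of_ereal[OF ell sigma(2)] by (simp add: lr_def[abs_def])

lemma g_eq: "t \<in> edom (g i) \<Longrightarrow> g i t = ereal (G i t)"
  using ext_on_edom[OF g(1), of i] by (metis G_def ext_on_def)

lemma csc_g: "closed_strongly_convex 0 (edom (g i)) (G i)"
  using closed_strongly_convex_of_ereal[OF g(1,2) strongly_convex_fun_0[OF g(3)]]
  by (simp add: G_def[abs_def])

lemma DG_iff: "y \<in> DG \<longleftrightarrow> (\<forall>i. y $ i \<in> edom (g i))"
proof -
  have "y \<in> DG \<longleftrightarrow> (\<Sum>i\<in>UNIV. g i (y $ i)) \<noteq> \<infinity>"
    using N2 by (cases "\<Sum>i\<in>UNIV. g i (y $ i)") (auto simp: edom_def gstar_def)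
  then show ?thesis by (auto simp: sum_Pinfty edom_def)
qed

lemma DG_eq: "DG = (\<Inter>i. {y. y $ i \<in> edom (g i)})"
  using DG_iff by auto

lemma gstar_eq: "y \<in> DG \<Longrightarrow> gstar g y = ereal (Gs y)"
proof -
  assume "y \<in> DG"
  then have "(\<Sum>i\<in>UNIV. g i (y $ i)) = ereal (\<Sum>i\<in>UNIV. G i (y $ i))"
    by (simp add: DG_iff g_eq flip: sum_ereal)
  then show ?thesis by (simp add: gstar_def Gs_def flip: N_def)
qed

lemma gstar_infinite: "y \<notin> DG \<Longrightarrow> gstar g y = \<infinity>"
  and ell_infinite: "x \<notin> DL \<Longrightarrow> ell x = \<infinity>"
  by (simp_all add: edom_def)

lemma csc_Gs: "closed_strongly_convex 0 DG Gs"
proof -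
  have "closed_strongly_convex 0 (\<Inter>i. {y::real^'n. y $ i \<in> edom (g i)}) (\<lambda>y. \<Sum>i\<in>UNIV. G i (y $ i))"
    by (intro closed_strongly_convex_sum closed_strongly_convex_coordinate csc_g) auto
  from closed_strongly_convex_scale[OF this, of "1 / N"] show ?thesis
    using N2 unfolding DG_eq Gs_def[abs_def] by simp
qed

lemma Psi_Suc: "k \<ge> 1 \<Longrightarrow> Psi yc js (Suc k) y = Psi yc js k y +
   a (Suc k) * (- (b (js (Suc k)) \<bullet> Xb js (Suc k)) * (y $ js (Suc k) - yc $ js (Suc k)) + G (js (Suc k)) (y $ js (Suc k)))"
  by (simp add: Psi_def)

lemma Phi_Suc: "Phi xc js (Suc k) x = Phi xc js k x + a (Suc k) * ((x - xc) \<bullet> \<zeta> js (Suc k) + lr x)"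
  by (simp add: Phi_def)

lemma csc_Psi: "k \<ge> 1 \<Longrightarrow> closed_strongly_convex N DG (Psi yc js k)"
proof (induction k rule: dec_induct)
  case base
  have "closed_strongly_convex (N + 0 + a 1 * 0) (UNIV \<inter> UNIV \<inter> DG)
     (\<lambda>y. N / 2 * (norm (y - y0))\<^sup>2 + (y \<bullet> (- a 1 *\<^sub>R Bmat b x0) + a 1 * (Bmat b x0 \<bullet> yc)) + a 1 * Gs y)"
    using st.ak_pos[of 1]
    by (intro closed_strongly_convex_add closed_strongly_convex_sq_norm closed_strongly_convex_affine
        closed_strongly_convex_scale csc_Gs) auto
  moreover have "(\<lambda>y. N / 2 * (norm (y - y0))\<^sup>2 + (y \<bullet> (- a 1 *\<^sub>R Bmat b x0) + a 1 * (Bmat b x0 \<bullet> yc)) + a 1 * Gs y)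
     = Psi yc js 1"
    by (auto simp: Psi_def inner_diff_right inner_commute algebra_simps)
  ultimately show ?case by simp
next
  case (step k)
  let ?j = "js (Suc k)" and ?c = "b (js (Suc k)) \<bullet> Xb js (Suc k)"
  let ?E = "{y::real^'n. y $ ?j \<in> edom (g ?j)}"
  have "closed_strongly_convex (N + a (Suc k) * (0 + 0)) (DG \<inter> (UNIV \<inter> ?E))
     (\<lambda>y. Psi yc js k y + a (Suc k) * ((y \<bullet> axis ?j (- ?c) + ?c * yc $ ?j) + G ?j (y $ ?j)))"
    using st.ak_pos[of "Suc k"]
    by (intro closed_strongly_convex_add step.IH closed_strongly_convex_affine
        closed_strongly_convex_scale closed_strongly_convex_coordinate csc_g) auto
  moreover have "DG \<inter> (UNIV \<inter> ?E) = DG" using DG_iff by auto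
  moreover have "(\<lambda>y. Psi yc js k y + a (Suc k) * ((y \<bullet> axis ?j (- ?c) + ?c * yc $ ?j) + G ?j (y $ ?j)))
     = Psi yc js (Suc k)"
    using step.hyps by (auto simp: Psi_Suc inner_axis algebra_simps)
  ultimately show ?case by simp
qed

lemma csc_Phi: "k \<ge> 1 \<Longrightarrow> closed_strongly_convex (N + \<sigma> * A k) DL (Phi xc js k)"
proof (induction k rule: nat_induct_at_least)
  have step: "closed_strongly_convex (\<mu> + a (Suc k) * (0 + \<sigma>)) (D \<inter> (UNIV \<inter> DL)) (Phi xc js (Suc k))"
    if "closed_strongly_convex \<mu> D (Phi xc js k)" for k \<mu> D
  proof -
    have "closed_strongly_convex (\<mu> + a (Suc k) * (0 + \<sigma>)) (D \<inter> (UNIV \<inter> DL))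
       (\<lambda>x. Phi xc js k x + a (Suc k) * ((x \<bullet> \<zeta> js (Suc k) + (- (xc \<bullet> \<zeta> js (Suc k)))) + lr x))"
      using st.ak_pos[of "Suc k"]
      by (intro closed_strongly_convex_add that closed_strongly_convex_affine
        closed_strongly_convex_scale csc_ell) auto
    then show ?thesis by (simp add: Phi_Suc[abs_def] inner_diff_left algebra_simps)
  qed
  {
    case base
    have "closed_strongly_convex N UNIV (Phi xc js 0)"
      using closed_strongly_convex_sq_norm[of N x0] by (simp add: Phi_def[abs_def])
    from step[OF this] show ?case by (simp add: Ak_1 ak_1 mult.commute)
  next
    case (Suc k)
    from step[OF Suc.IH] show ?case by (simp add: Ak_Suc algebra_simps)
  }
qed

lemma Psi_shift: "Psi yc js k y - Psi yc js k y' = Psi yc' js k y - Psi yc' js k y'"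
proof -
  have "(\<Sum>i=2..k. a i * (- (b (js i) \<bullet> Xb js i) * (y $ js i - yc $ js i) + G (js i) (y $ js i)))
      - (\<Sum>i=2..k. a i * (- (b (js i) \<bullet> Xb js i) * (y' $ js i - yc $ js i) + G (js i) (y' $ js i)))
      = (\<Sum>i=2..k. a i * (- (b (js i) \<bullet> Xb js i) * (y $ js i - yc' $ js i) + G (js i) (y $ js i)))
      - (\<Sum>i=2..k. a i * (- (b (js i) \<bullet> Xb js i) * (y' $ js i - yc' $ js i) + G (js i) (y' $ js i)))"
    unfolding sum_subtractf[symmetric] by (intro sum.cong) (auto simp: algebra_simps)
  then show ?thesis by (simp add: Psi_def inner_diff_right algebra_simps)
qed

lemma Phi_shift: "Phi xc js k x - Phi xc js k x' = Phi xc' js k x - Phi xc' js k x'"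
proof -
  have "(\<Sum>i=1..k. a i * ((x - xc) \<bullet> \<zeta> js i + lr x)) - (\<Sum>i=1..k. a i * ((x' - xc) \<bullet> \<zeta> js i + lr x'))
      = (\<Sum>i=1..k. a i * ((x - xc') \<bullet> \<zeta> js i + lr x)) - (\<Sum>i=1..k. a i * ((x' - xc') \<bullet> \<zeta> js i + lr x'))"
    unfolding sum_subtractf[symmetric] by (intro sum.cong) (auto simp: inner_diff_left algebra_simps)
  then show ?thesis by (simp add: Phi_def)
qed

definition "mix j y w = (\<chi> i. if i = j then y $ i else w $ i)"

lemma sum_mix: "(\<Sum>i\<in>UNIV. h i (mix j y w $ i)) + (\<Sum>i\<in>UNIV. h i (mix j w y $ i))
    = (\<Sum>i\<in>UNIV. h i (y $ i)) + (\<Sum>i\<in>UNIV. (h i (w $ i) :: real))"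
  unfolding sum.distrib[symmetric] by (intro sum.cong) (auto simp: mix_def)

text \<open>All parts of \<open>Psi\<close> are sums of functions of one coordinate, and in each
  coordinate the two mixtures carry together the same two values as y and w.\<close>

lemma Psi_mix: "Psi yc js k (mix j y w) + Psi yc js k (mix j w y) = Psi yc js k y + Psi yc js k w"
proof -
  have "(norm (mix j y w - y0))\<^sup>2 + (norm (mix j w y - y0))\<^sup>2 = (norm (y - y0))\<^sup>2 + (norm (w - y0))\<^sup>2"
    using sum_mix[of "\<lambda>i t. (t - y0 $ i)\<^sup>2"] by (simp add: norm_sq_vec)
  from arg_cong[OF this, of "\<lambda>t. N / 2 * t"]
  have 1: "N / 2 * (norm (mix j y w - y0))\<^sup>2 + N / 2 * (norm (mix j w y - y0))\<^sup>2
      = N / 2 * (norm (y - y0))\<^sup>2 + N / 2 * (norm (w - y0))\<^sup>2"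
    by (simp only: distrib_left)
  have 2: "Bmat b x0 \<bullet> (mix j y w - yc) + Bmat b x0 \<bullet> (mix j w y - yc) = Bmat b x0 \<bullet> (y - yc) + Bmat b x0 \<bullet> (w - yc)"
    using sum_mix[of "\<lambda>i t. Bmat b x0 $ i * (t - yc $ i)"] by (simp add: inner_vec_def)
  have 3: "Gs (mix j y w) + Gs (mix j w y) = Gs y + Gs w"
    using sum_mix[of G] by (simp add: Gs_def add_divide_distrib[symmetric])
  let ?S = "\<lambda>y. \<Sum>i=2..k. a i * (- (b (js i) \<bullet> Xb js i) * (y $ js i - yc $ js i) + G (js i) (y $ js i))"
  have 4: "?S (mix j y w) + ?S (mix j w y) = ?S y + ?S w"
    unfolding sum.distrib[symmetric] by (intro sum.cong) (auto simp: mix_def)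
  have "p1 + q1 * (- r1 + s1) + t1 + (p2 + q1 * (- r2 + s2) + t2) = p3 + q1 * (- r3 + s3) + t3 + (p4 + q1 * (- r4 + s4) + t4)"
    if "p1 + p2 = p3 + p4" "r1 + r2 = r3 + r4" "s1 + s2 = s3 + s4" "t1 + t2 = t3 + t4"
    for p1 p2 p3 p4 q1 r1 r2 r3 r4 s1 s2 s3 s4 t1 t2 t3 t4 :: real
    using that by (metis (no_types, opaque_lifting) add.assoc add.left_commute distrib_left minus_add_distrib)
  from this[OF 1 2 3 4] show ?thesis unfolding Psi_def .
qed

lemma Psi_minimal_growth:
  assumes "k \<ge> 1" "y \<in> DG" "\<And>w. w \<in> DG \<Longrightarrow> Psi v js k y \<le> Psi v js k w" "w \<in> DG"
  shows "Psi yc js k w \<ge> Psi yc js k y + N / 2 * (norm (w - y))\<^sup>2"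
  using closed_strongly_convex_min_growth[OF csc_Psi[OF assms(1)] assms(2,3,4)]
    Psi_shift[of yc js k w y v] by simp

lemma Phi_minimal_growth:
  assumes "k \<ge> 1" "x \<in> DL" "\<And>w. w \<in> DL \<Longrightarrow> Phi u js k x \<le> Phi u js k w" "w \<in> DL"
  shows "Phi xc js k w \<ge> Phi xc js k x + (N + \<sigma> * A k) / 2 * (norm (w - x))\<^sup>2"
  using closed_strongly_convex_min_growth[OF csc_Phi[OF assms(1)] assms(2,3,4)]
    Phi_shift[of xc js k w x u] by simp

text \<open>\<open>\<psi>\<^sub>k\<close> is separable, and one step changes only its \<open>j\<close>-th summand: exchanging the coordinates other than
  \<open>j\<close> between the two minimisers does not increase the total value, so by uniqueness they agree.\<close>

lemma Psi_minimisers_agree: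
  assumes "k \<ge> 1"
    and y: "y \<in> DG" "\<And>w. w \<in> DG \<Longrightarrow> Psi v js k y \<le> Psi v js k w"
    and y': "y' \<in> DG" "\<And>w. w \<in> DG \<Longrightarrow> Psi v js (Suc k) y' \<le> Psi v js (Suc k) w"
    and "i \<noteq> js (Suc k)"
  shows "y' $ i = y $ i"
proof -
  let ?m = "mix (js (Suc k)) y' y" and ?m' = "mix (js (Suc k)) y y'"
  have D: "?m \<in> DG" "?m' \<in> DG" using y(1) y'(1) by (auto simp: DG_iff mix_def)
  have "Psi v js (Suc k) ?m - Psi v js k ?m = Psi v js (Suc k) y' - Psi v js k y'"
    using assms(1) by (simp add: Psi_Suc mix_def)
  moreover have "Psi v js k ?m + Psi v js k ?m' = Psi v js k y' + Psi v js k y" by (rule Psi_mix)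
  moreover have "Psi v js k y \<le> Psi v js k ?m'" using y(2) D by blast
  moreover have "Psi v js (Suc k) ?m \<ge> Psi v js (Suc k) y' + N / 2 * (norm (?m - y'))\<^sup>2"
    using Psi_minimal_growth[of "Suc k" y' js ?m v] y' D by simp
  ultimately have "N / 2 * (norm (?m - y'))\<^sup>2 \<le> 0" by linarith
  then have "?m = y'" using N2 by (simp add: mult_le_0_iff)
  then have "?m $ i = y' $ i" by simp
  then show ?thesis using assms(6) by (simp add: mix_def)
qed

lemma BT_change_coordinate:
  assumes "\<And>i. i \<noteq> j \<Longrightarrow> y' $ i = y $ i"
  shows "BT b y' = BT b y + ((y' $ j - y $ j) / N) *\<^sub>R b j"
proof -
  have "(\<Sum>i\<in>UNIV. (y' $ i) *\<^sub>R b i) - (\<Sum>i\<in>UNIV. (y $ i) *\<^sub>R b i) = (\<Sum>i\<in>UNIV. (y' $ i - y $ i) *\<^sub>R b i)"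
    by (simp add: sum_subtractf scaleR_diff_left)
  also have "\<dots> = (\<Sum>i\<in>UNIV. if i = j then (y' $ j - y $ j) *\<^sub>R b j else 0)"
    using assms by (intro sum.cong) auto
  finally have "(\<Sum>i\<in>UNIV. (y' $ i) *\<^sub>R b i) = (\<Sum>i\<in>UNIV. (y $ i) *\<^sub>R b i) + (y' $ j - y $ j) *\<^sub>R b j"
    by (simp add: algebra_simps)
  then show ?thesis by (simp add: BT_def scaleR_add_right flip: N_def)
qed

section \<open>The algorithm's state in terms of the estimate sequences\<close>

definition "minimal js k \<longleftrightarrow>
  Y js k \<in> DG \<and> (\<forall>w\<in>DG. Psi v js k (Y js k) \<le> Psi v js k w) \<and>
  X js k \<in> DL \<and> (\<forall>w\<in>DL. Phi u js k (X js k) \<le> Phi u js k w)"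

lemma vrpda_state_1:
  "vrpda b g ell R \<sigma> x0 y0 u v js (Suc 0) =
     (ext_on DG (Psi v js (Suc 0)), ext_on DL (Phi u js (Suc 0)),
      Y js (Suc 0), X js (Suc 0), x0, BT b (Y js (Suc 0))) \<and> minimal js (Suc 0)"
proof -
  define psit where "psit = (\<lambda>y. ereal ((norm (y - y0))\<^sup>2 / 2)
    + ereal (1 / (2 * R)) * (ereal (- (Bmat b x0 \<bullet> (y - v))) + gstar g y))"
  define phit where "phit = (\<lambda>x. ereal ((norm (x - x0))\<^sup>2 / 2)
    + ereal (1 / (2 * R)) * (ereal ((x - u) \<bullet> BT b (argmin psit)) + ell x))"
  have st: "vrpda b g ell R \<sigma> x0 y0 u v js (Suc 0) =
     ((\<lambda>y. ereal N * psit y), (\<lambda>x. ereal N * phit x), argmin psit, argmin phit, x0, BT b (argmin psit))"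
    by (simp add: Let_def psit_def phit_def N_def)
  have Y1: "Y js (Suc 0) = argmin psit" and X1: "X js (Suc 0) = argmin phit"
    by (simp_all only: yk_def xk_def st fst_conv snd_conv)
  have N0: "N > 0" using N2 by simp
  \<comment> \<open>The first minimisers are taken before scaling by n, hence of \<open>Psi\<close>
    and \<open>Phi\<close> divided by N; this matches because a 1 / N = 1 / (2R).\<close>
  have psit: "psit = ext_on DG (\<lambda>y. Psi v js (Suc 0) y / N)"
  proof
    fix y
    show "psit y = ext_on DG (\<lambda>y. Psi v js (Suc 0) y / N) y"
      using R N0 by (cases "y \<in> DG")
        (simp_all add: psit_def gstar_eq gstar_infinite ext_on_def Psi_def ak_1 field_simps)
  qed
  have phit: "phit = ext_on DL (\<lambda>x. Phi u js (Suc 0) x / N)"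
  proof
    fix x
    show "phit x = ext_on DL (\<lambda>x. Phi u js (Suc 0) x / N) x"
      unfolding phit_def Y1[symmetric] using R N0 by (cases "x \<in> DL")
        (simp_all add: ell_eq ell_infinite ext_on_def Phi_def \<zeta>_def ak_1 field_simps)
  qed
  have "closed_strongly_convex (1 / N * N) DG (\<lambda>y. 1 / N * Psi v js (Suc 0) y)"
    using N0 by (intro closed_strongly_convex_scale csc_Psi) auto
  then have cP: "closed_strongly_convex (1 / N * N) DG (\<lambda>y. Psi v js (Suc 0) y / N)" by simp
  have "closed_strongly_convex (1 / N * (N + \<sigma> * A (Suc 0))) DL (\<lambda>x. 1 / N * Phi u js (Suc 0) x)"
    using N0 by (intro closed_strongly_convex_scale csc_Phi) auto
  then have cQ: "closed_strongly_convex (1 / N * (N + \<sigma> * A (Suc 0))) DL (\<lambda>x. Phi u js (Suc 0) x / N)" by simp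
  have pos: "1 / N * (N + \<sigma> * A (Suc 0)) > 0"
    using N0 sigma st.Ak_nonneg[of "Suc 0"] by (intro mult_pos_pos add_pos_nonneg) auto
  have "minimal js (Suc 0)"
    unfolding minimal_def Y1 X1 psit phit
    using argmin_ext_on[OF cP _ uv(2)] argmin_ext_on[OF cQ pos uv(1)] N0
    by (auto simp: divide_le_cancel)
  moreover have "(\<lambda>y. ereal N * psit y) = ext_on DG (Psi v js (Suc 0))"
    using N0 by (auto simp: psit ext_on_def)
  moreover have "(\<lambda>x. ereal N * phit x) = ext_on DL (Phi u js (Suc 0))"
    using N0 by (auto simp: phit ext_on_def)
  ultimately show ?thesis unfolding st Y1 X1 by blast
qed

lemma X_0: "X js 0 = x0"
  by (simp add: xk_def)

text \<open>The induction has to carry the two functions, minimality and z_k = B^T y_k together: the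
  algorithm corrects z in one coordinate only, so the identity for z rests on consecutive y agreeing
  elsewhere, which follows from minimality of both.\<close>

lemma vrpda_state:
  "vrpda b g ell R \<sigma> x0 y0 u v js (Suc m) =
     (ext_on DG (Psi v js (Suc m)), ext_on DL (Phi u js (Suc m)),
      Y js (Suc m), X js (Suc m), X js m, BT b (Y js (Suc m))) \<and> minimal js (Suc m)"
proof (induction m)
  case 0
  then show ?case using vrpda_state_1 by (simp add: X_0)
next
  case (Suc m)
  define k where "k = Suc m"
  note IH = Suc.IH[THEN conjunct1, folded k_def] Suc.IH[THEN conjunct2, folded k_def]
  have k1: "k \<ge> 1" "k - 1 = m" by (simp_all add: k_def)
  define j where "j = js (Suc k)"
  define psi' where "psi' = (\<lambda>y'. ext_on DG (Psi v js k) y' +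
     ereal (a (Suc k)) * (ereal (- (b j \<bullet> (X js k + (a k / a (Suc k)) *\<^sub>R (X js k - X js m))) * (y' $ j - v $ j)) + g j (y' $ j)))"
  define phi' where "phi' = (\<lambda>x'. ext_on DL (Phi u js k) x' + ereal (a (Suc k)) *
     (ereal ((x' - u) \<bullet> (BT b (Y js k) + (argmin psi' $ j - Y js k $ j) *\<^sub>R b j)) + ell x'))"
  have st: "vrpda b g ell R \<sigma> x0 y0 u v js (Suc k) =
     (psi', phi', argmin psi', argmin phi', X js k, BT b (Y js k) + ((argmin psi' $ j - Y js k $ j) / N) *\<^sub>R b j)"
    unfolding k_def vrpda.simps(3)
    unfolding k_def[symmetric] IH(1)
    by (simp add: Let_def psi'_def phi'_def j_def N_def)
  have Y1: "Y js (Suc k) = argmin psi'" and X1: "X js (Suc k) = argmin phi'"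
    by (simp_all only: yk_def xk_def st fst_conv snd_conv)
  have psi': "psi' = ext_on DG (Psi v js (Suc k))"
  proof
    fix y
    show "psi' y = ext_on DG (Psi v js (Suc k)) y"
    proof (cases "y \<in> DG")
      case True
      then have "g j (y $ j) = ereal (G j (y $ j))" by (simp add: DG_iff g_eq)
      then show ?thesis using True k1
        by (simp add: psi'_def ext_on_def Psi_Suc Xb_def j_def numeral_2_eq_2)
    qed (simp add: psi'_def ext_on_def)
  qed
  have phi': "phi' = ext_on DL (Phi u js (Suc k))"
  proof
    fix x
    show "phi' x = ext_on DL (Phi u js (Suc k)) x"
    proof (cases "x \<in> DL")
      case True
      then have "ell x = ereal (lr x)" by (rule ell_eq)
      then show ?thesis using True k1
        by (simp add: phi'_def ext_on_def Phi_Suc \<zeta>_def Y1 j_def)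
    qed (simp add: phi'_def ext_on_def)
  qed
  have pos: "N + \<sigma> * A (Suc k) > 0"
    using N2 sigma st.Ak_nonneg[of "Suc k"] by (intro add_pos_nonneg) auto
  have min: "minimal js (Suc k)"
    unfolding minimal_def Y1 X1 psi' phi'
    using argmin_ext_on[OF csc_Psi[of "Suc k" v js] _ uv(2)] argmin_ext_on[OF csc_Phi[of "Suc k" u js] pos uv(1)] N2
    by auto
  have "BT b (Y js (Suc k)) = BT b (Y js k) + ((Y js (Suc k) $ j - Y js k $ j) / N) *\<^sub>R b j"
  proof (rule BT_change_coordinate)
    show "Y js (Suc k) $ i = Y js k $ i" if "i \<noteq> j" for i
      using Psi_minimisers_agree[OF k1(1), of "Y js k" js "Y js (Suc k)" i] IH(2) min that
      unfolding minimal_def j_def by blast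
  qed
  then have "vrpda b g ell R \<sigma> x0 y0 u v js (Suc k) =
     (ext_on DG (Psi v js (Suc k)), ext_on DL (Phi u js (Suc k)), Y js (Suc k), X js (Suc k), X js k, BT b (Y js (Suc k)))"
    unfolding st Y1 X1 using psi' phi' by simp
  then show ?case using min unfolding k_def by blast
qed

lemma minimal: "k \<ge> 1 \<Longrightarrow> minimal js k"
  using vrpda_state[of js "k - 1"] by simp

lemma Y_in_DG: "k \<ge> 1 \<Longrightarrow> Y js k \<in> DG"
  and X_in_DL: "k \<ge> 1 \<Longrightarrow> X js k \<in> DL"
  using minimal unfolding minimal_def by blast+

lemma Y_coordinate: "k \<ge> 1 \<Longrightarrow> i \<noteq> js (Suc k) \<Longrightarrow> Y js (Suc k) $ i = Y js k $ i"
  using Psi_minimisers_agree[of k "Y js k" js "Y js (Suc k)" i] minimal[of k js] minimal[of "Suc k" js]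
  unfolding minimal_def by auto

lemma Psi_growth:
  "k \<ge> 1 \<Longrightarrow> w \<in> DG \<Longrightarrow> Psi yc js k w \<ge> Psi yc js k (Y js k) + N / 2 * (norm (w - Y js k))\<^sup>2"
  using Psi_minimal_growth[of k "Y js k" js w yc] minimal[of k js] unfolding minimal_def by blast

lemma Phi_growth:
  "k \<ge> 1 \<Longrightarrow> w \<in> DL \<Longrightarrow> Phi xc js k w \<ge> Phi xc js k (X js k) + (N + \<sigma> * A k) / 2 * (norm (w - X js k))\<^sup>2"
  using Phi_minimal_growth[of k "X js k" js w xc] minimal[of k js] unfolding minimal_def by blast

section \<open>The inequality along one realisation\<close>

lemma sum_a: "(\<Sum>i=1..k. a i) = A k"
  by (induction k) (simp_all add: Ak_Suc)

lemma Gs_coordinate_change: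
  assumes "\<forall>i. i \<noteq> j \<longrightarrow> y' $ i = y $ i"
  shows "G j (y' $ j) = N * Gs y' - N * Gs y + G j (y $ j)"
  using sum_coordinate_change[OF assms, of G] N2 by (simp add: Gs_def field_simps)

text \<open>The factor N undoes the 1/N inside \<open>Bmat\<close>; this is how a sampled coupling
  term becomes a coupling of whole vectors.\<close>

lemma Bmat_coordinate_change:
  assumes "\<forall>i. i \<noteq> j \<longrightarrow> y' $ i = y $ i"
  shows "(b j \<bullet> x) * (y' $ j - y $ j) = N * (Bmat b x \<bullet> (y' - y))"
proof -
  have "N * (Bmat b x \<bullet> y) = (\<Sum>i\<in>UNIV. (b i \<bullet> x) * y $ i)" for y
    using N2 by (simp add: inner_Bmat flip: N_def)
  then show ?thesis
    using sum_coordinate_change[OF assms, of "\<lambda>i t. (b i \<bullet> x) * t"]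
    by (simp add: inner_diff_right right_diff_distrib)
qed

lemma inner_b_bound: "\<bar>b j \<bullet> x\<bar> \<le> R * norm x"
  using Cauchy_Schwarz_ineq2[of "b j" x] mult_right_mono[OF bnorm[of j] norm_ge_zero[of x]] by linarith

lemma Bmat_bound: "\<bar>Bmat b x \<bullet> y\<bar> \<le> R * norm x * norm y"
proof -
  have "\<bar>\<Sum>i\<in>UNIV. (b i \<bullet> x) * y $ i\<bar> \<le> (\<Sum>i\<in>UNIV. \<bar>(b i \<bullet> x) * y $ i\<bar>)" by (rule sum_abs)
  also have "\<dots> \<le> (\<Sum>i\<in>(UNIV::'n set). R * norm x * norm y)"
    unfolding abs_mult using R component_le_norm_cart
    by (intro sum_mono mult_mono inner_b_bound) auto
  finally show ?thesis using N2 by (simp add: inner_Bmat abs_divide field_simps flip: N_def)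
qed

text \<open>When a single coordinate changes, even N times the coupling has constant R;
  \<open>Bmat_bound\<close> would give only N * R.\<close>

lemma Bmat_coordinate_bound:
  assumes "\<forall>i. i \<noteq> j \<longrightarrow> y' $ i = y $ i"
  shows "\<bar>N * (Bmat b x \<bullet> (y' - y))\<bar> \<le> R * norm x * norm (y' - y)"
proof -
  have "\<bar>(b j \<bullet> x) * (y' $ j - y $ j)\<bar> \<le> (R * norm x) * norm (y' - y)"
    unfolding abs_mult using R component_le_norm_cart[of "y' - y" j]
    by (intro mult_mono inner_b_bound) auto
  then show ?thesis unfolding Bmat_coordinate_change[OF assms] .
qed

text \<open>The i-th increment of \<open>Psi\<close> for a candidate index j, at the previous
  iterate minus at the comparison point. The previous iterate is used because the new one already
  depends on j_i.\<close>

definition "noise yc js i j = - (b j \<bullet> Xb js i) * (Y js (i - 1) $ j - yc $ j)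
  + G j (Y js (i - 1) $ j) - G j (yc $ j)"

definition "mart yc js i = a i * (noise yc js i (js i) - (\<Sum>j\<in>UNIV. noise yc js i j) / N)"

text \<open>The part of -L(xc, y) that depends on y.\<close>

definition "Hf xc y = Gs y - Bmat b xc \<bullet> y"

lemma noise_mean: "(\<Sum>j\<in>UNIV. noise yc js i j) / N =
   - (Bmat b (Xb js i) \<bullet> (Y js (i - 1) - yc)) + Gs (Y js (i - 1)) - Gs yc"
  unfolding inner_Bmat Gs_def N_def[symmetric] noise_def
  by (simp add: sum_subtractf sum.distrib sum_negf diff_divide_distrib add_divide_distrib)

text \<open>The weighted gap before summation by parts, without its constant part A k * (lr xc + Gs
  yc).\<close>

definition "gap_sum xc yc js k = (\<Sum>i=1..k. a i * (Bmat b (X js i) \<bullet> yc + lr (X js i)))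
  + a 1 * Hf xc (Y js 1) + (\<Sum>i=2..k. a i * (N * Hf xc (Y js i) - (N - 1) * Hf xc (Y js (i - 1))))"

text \<open>The coupling term and the quarter of the squared displacement are carried for the next
  step, where the first telescopes and the second pays for a cross term. The terms with G at yc
  cancel later against the same terms in \<open>Psi\<close> at yc.\<close>

lemma estimate_lower_bound:
  "k \<ge> 1 \<Longrightarrow> Psi yc js k (Y js k) + Phi xc js k (X js k) \<ge>
     a k * (Bmat b (X js k - X js (k - 1)) \<bullet> (Y js k - yc))
     + (N + \<sigma> * A (k - 1)) / 4 * (norm (X js k - X js (k - 1)))\<^sup>2
     + gap_sum xc yc js k
     + (\<Sum>i=2..k. mart yc js i + a i * (G (js i) (yc $ js i) - Gs yc))"
proof (induction k rule: dec_induct)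
  case base
  have \<zeta>: "x \<bullet> \<zeta> js 1 = Bmat b x \<bullet> Y js 1" for x
    by (simp add: \<zeta>_def inner_BT[symmetric] inner_commute)
  have eq: "Psi yc js 1 (Y js 1) + Phi xc js 1 (X js 1) = a 1 * (Bmat b (X js 1 - X js 0) \<bullet> (Y js 1 - yc))
      + gap_sum xc yc js 1 + (N / 2 * (norm (Y js 1 - y0))\<^sup>2 + N / 2 * (norm (X js 1 - x0))\<^sup>2)"
    by (simp add: Psi_def Phi_def gap_sum_def Hf_def \<zeta> X_0 Bmat_diff inner_diff_right inner_diff_left algebra_simps del: One_nat_def)
  have "N / 4 * (norm (X js 1 - x0))\<^sup>2 \<le> N / 2 * (norm (X js 1 - x0))\<^sup>2" "0 \<le> N / 2 * (norm (Y js 1 - y0))\<^sup>2"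
    using N2 by (auto intro!: mult_right_mono)
  then show ?case unfolding eq by (simp add: X_0)
next
  case (step m)
  define k where "k = Suc m"
  define j where "j = js k"
  define dY where "dY = Y js k - Y js m"
  define D where "D = X js k - X js m"
  define D' where "D' = X js m - X js (m - 1)"
  have coord: "\<forall>i. i \<noteq> j \<longrightarrow> Y js k $ i = Y js m $ i"
    using Y_coordinate[of m _ js] step.hyps by (simp add: k_def j_def)
  have mk: "k - 1 = m" "k - 2 = m - 1" "k \<noteq> 1" "k \<ge> 1" using step.hyps by (auto simp: k_def)
  have ak: "a k > 0" using st.ak_pos mk by simp
  have Xb: "a k *\<^sub>R (X js k - Xb js k) = a k *\<^sub>R D - a m *\<^sub>R D'"
    unfolding Xb_def D_def D'_def mk using ak by (simp add: algebra_simps)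
  have \<zeta>: "x \<bullet> \<zeta> js k = Bmat b x \<bullet> (Y js m + N *\<^sub>R dY)" for x
  proof -
    have "x \<bullet> \<zeta> js k = Bmat b x \<bullet> Y js m + (b j \<bullet> x) * (Y js k $ j - Y js m $ j)"
      using mk by (simp add: \<zeta>_def inner_add_right inner_BT[symmetric] inner_commute j_def)
    then show ?thesis unfolding Bmat_coordinate_change[OF coord]
      by (simp add: inner_add_right dY_def)
  qed
  \<comment> \<open>The change of G in coordinate j is N times the change of \<open>Gs\<close>, and
    the old value of G there is its mean \<open>Gs (Y js m)\<close> plus noise; hence the
    coefficients N and N - 1.\<close>
  have psi_term: "- (b j \<bullet> Xb js k) * (Y js k $ j - yc $ j) + G j (Y js k $ j)
     = (noise yc js k j - (\<Sum>j\<in>UNIV. noise yc js k j) / N) + (G j (yc $ j) - Gs yc)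
       - Bmat b (Xb js k) \<bullet> (Y js m + N *\<^sub>R dY - yc) + N * Gs (Y js k) - (N - 1) * Gs (Y js m)"
  proof -
    have "(b j \<bullet> Xb js k) * (Y js k $ j - yc $ j)
        = N * (Bmat b (Xb js k) \<bullet> dY) + (b j \<bullet> Xb js k) * (Y js m $ j - yc $ j)"
      unfolding dY_def Bmat_coordinate_change[OF coord, symmetric] by (simp add: algebra_simps)
    moreover have "noise yc js k j = - (b j \<bullet> Xb js k) * (Y js m $ j - yc $ j)
        + G j (Y js m $ j) - G j (yc $ j)" by (simp add: noise_def mk(1)[simplified])
    ultimately show ?thesis
      unfolding noise_mean mk Gs_coordinate_change[OF coord]
      by (simp add: inner_add_right inner_diff_right algebra_simps)
  qed
  \<comment> \<open>Primal and dual increments meet the same vector Y_m + N dY. By extrapolation a_k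
    (X_k - Xb_k) = a_k D - a_m D', so a difference of consecutive couplings appears, plus two cross
    terms in dY.\<close>
  have bil: "a k * (Bmat b (X js k) \<bullet> (Y js m + N *\<^sub>R dY)) - a k * (Bmat b (Xb js k) \<bullet> (Y js m + N *\<^sub>R dY - yc))
     = a k * (Bmat b D \<bullet> (Y js k - yc)) - a m * (Bmat b D' \<bullet> (Y js m - yc))
       + a k * (Bmat b (X js k) \<bullet> yc) + a k * ((N - 1) * (Bmat b D \<bullet> dY)) - a m * (N * (Bmat b D' \<bullet> dY))"
  proof -
    let ?w = "Y js m + N *\<^sub>R dY - yc"
    have "a k * (Bmat b (X js k) \<bullet> ?w) - a k * (Bmat b (Xb js k) \<bullet> ?w) = Bmat b (a k *\<^sub>R (X js k - Xb js k)) \<bullet> ?w"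
      by (simp add: Bmat_scaleR Bmat_diff inner_diff_left algebra_simps)
    also have "\<dots> = a k * (Bmat b D \<bullet> ?w) - a m * (Bmat b D' \<bullet> ?w)"
      unfolding Xb by (simp add: Bmat_diff Bmat_scaleR inner_diff_left)
    also have "Bmat b D \<bullet> ?w = Bmat b D \<bullet> (Y js k - yc) + (N - 1) * (Bmat b D \<bullet> dY)"
      by (simp add: dY_def inner_add_right inner_diff_right algebra_simps)
    also have "Bmat b D' \<bullet> ?w = Bmat b D' \<bullet> (Y js m - yc) + N * (Bmat b D' \<bullet> dY)"
      by (simp add: inner_add_right inner_diff_right algebra_simps)
    finally show ?thesis
      by (simp add: inner_add_right inner_diff_right algebra_simps)
  qed
  define c where "c = N + \<sigma> * A m"
  define c' where "c' = N + \<sigma> * A (m - 1)"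
  have c: "c \<ge> 0" "c' \<ge> 0" using N2 sigma st.Ak_nonneg by (auto simp: c_def c'_def)
  \<comment> \<open>The budget: growth of \<open>Psi\<close> gives N/2 |dY|^2, shared equally by E1
    and E2; growth of \<open>Phi\<close> gives c/2 |D|^2, half for E1 and half for the new
    invariant; E2 uses up c'/4 |D'|^2 from the induction hypothesis.\<close>
  have E1: "a k * ((N - 1) * (Bmat b D \<bullet> dY)) \<ge> - (N / 4 * (norm dY)\<^sup>2 + c / 4 * (norm D)\<^sup>2)"
  proof -
    have "\<bar>(N - 1) * (Bmat b D \<bullet> dY)\<bar> \<le> \<bar>N * (Bmat b D \<bullet> dY)\<bar>"
      unfolding abs_mult using N2 by (intro mult_right_mono) auto
    also have "\<dots> \<le> R * norm D * norm dY"
      unfolding dY_def by (rule Bmat_coordinate_bound[OF coord])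
    finally have "- (R * norm D * norm dY) \<le> (N - 1) * (Bmat b D \<bullet> dY)" by linarith
    then have "a k * - (R * norm D * norm dY) \<le> a k * ((N - 1) * (Bmat b D \<bullet> dY))"
      using ak by (intro mult_left_mono) auto
    moreover have "a k * (R * norm D * norm dY) \<le> N / 4 * (norm dY)\<^sup>2 + c / 4 * (norm D)\<^sup>2"
      using c N2 R st.ak_le_sqrt[of m] by (intro weighted_AM_GM) (auto simp: c_def k_def)
    ultimately show ?thesis by simp
  qed
  have E2: "a m * (N * (Bmat b D' \<bullet> dY)) \<le> N / 4 * (norm dY)\<^sup>2 + c' / 4 * (norm D')\<^sup>2"
  proof -
    have "\<bar>N * (Bmat b D' \<bullet> dY)\<bar> \<le> R * norm D' * norm dY"
      unfolding dY_def by (rule Bmat_coordinate_bound[OF coord])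
    then have "N * (Bmat b D' \<bullet> dY) \<le> R * norm D' * norm dY" by linarith
    then have "a m * (N * (Bmat b D' \<bullet> dY)) \<le> a m * (R * norm D' * norm dY)"
      using st.ak_pos[of m] step.hyps by (intro mult_left_mono) auto
    also have "\<dots> \<le> N / 4 * (norm dY)\<^sup>2 + c' / 4 * (norm D')\<^sup>2"
      using c N2 R st.ak_le_sqrt[of "m - 1"] step.hyps by (intro weighted_AM_GM) (auto simp: c'_def)
    finally show ?thesis .
  qed
  have P: "Psi yc js k (Y js k) \<ge> Psi yc js m (Y js m) + N / 2 * (norm dY)\<^sup>2
      + a k * (- (b j \<bullet> Xb js k) * (Y js k $ j - yc $ j) + G j (Y js k $ j))"
    using Psi_growth[of m "Y js k" yc js] Y_in_DG[of k js] step.hyps mk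
    unfolding dY_def j_def k_def by (simp add: Psi_Suc)
  have Q: "Phi xc js k (X js k) \<ge> Phi xc js m (X js m) + c / 2 * (norm D)\<^sup>2
      + a k * (Bmat b (X js k) \<bullet> (Y js m + N *\<^sub>R dY) - Bmat b xc \<bullet> (Y js m + N *\<^sub>R dY) + lr (X js k))"
  proof -
    have "Phi xc js m (X js k) \<ge> Phi xc js m (X js m) + c / 2 * (norm D)\<^sup>2"
      using Phi_growth[of m "X js k" xc js] X_in_DL[of k js] step.hyps mk
      unfolding D_def c_def by simp
    moreover have "Phi xc js k (X js k) = Phi xc js m (X js k) + a k * ((X js k - xc) \<bullet> \<zeta> js k + lr (X js k))"
      unfolding k_def Phi_Suc ..
    ultimately show ?thesis unfolding \<zeta> Bmat_diff inner_diff_left by simp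
  qed
  have H: "N * Hf xc (Y js k) - (N - 1) * Hf xc (Y js m)
     = N * Gs (Y js k) - (N - 1) * Gs (Y js m) - Bmat b xc \<bullet> (Y js m + N *\<^sub>R dY)"
    by (simp add: Hf_def dY_def inner_add_right inner_diff_right algebra_simps)
  have gs: "gap_sum xc yc js k = gap_sum xc yc js m + a k * (Bmat b (X js k) \<bullet> yc + lr (X js k))
      + a k * (N * Gs (Y js k) - (N - 1) * Gs (Y js m) - Bmat b xc \<bullet> (Y js m + N *\<^sub>R dY))"
    unfolding H[symmetric] using step.hyps by (simp add: gap_sum_def k_def)
  have ms: "(\<Sum>i=2..k. mart yc js i + a i * (G (js i) (yc $ js i) - Gs yc))
     = (\<Sum>i=2..m. mart yc js i + a i * (G (js i) (yc $ js i) - Gs yc))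
       + a k * (noise yc js k j - (\<Sum>j\<in>UNIV. noise yc js k j) / N) + a k * (G j (yc $ j) - Gs yc)"
    using step.hyps by (simp add: k_def mart_def j_def)
  note IH = step.IH[folded D'_def c'_def]
  have "a k * (Bmat b D \<bullet> (Y js k - yc)) + c / 4 * (norm D)\<^sup>2 + gap_sum xc yc js k
      + (\<Sum>i=2..k. mart yc js i + a i * (G (js i) (yc $ js i) - Gs yc))
      \<le> Psi yc js k (Y js k) + Phi xc js k (X js k)"
    using IH P Q bil E1 E2 unfolding gs ms psi_term
    by (simp only: distrib_left right_diff_distrib)
  then show ?case unfolding D_def c_def k_def by simp
qed

text \<open>At the comparison point all linear terms vanish, so \<open>Psi\<close> and
  \<open>Phi\<close> are explicit there. Their growth around the iterates gives the distances, and
  the remaining coupling consumes the carried displacement and half of the dual distance.\<close>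

lemma pathwise_bound:
  assumes k: "k \<ge> 1" and xc: "xc \<in> DL" and yc: "yc \<in> DG"
  shows "N / 4 * (norm (yc - Y js k))\<^sup>2 + (N + \<sigma> * A k) / 2 * (norm (xc - X js k))\<^sup>2
     + (gap_sum xc yc js k - A k * (lr xc + Gs yc)) + (\<Sum>i=2..k. mart yc js i)
     \<le> N * ((norm (xc - x0))\<^sup>2 + (norm (yc - y0))\<^sup>2) / 2"
proof -
  let ?D = "X js k - X js (k - 1)" and ?c = "N + \<sigma> * A (k - 1)"
  have Psi: "Psi yc js k yc = N / 2 * (norm (yc - y0))\<^sup>2 + a 1 * Gs yc + (\<Sum>i=2..k. a i * G (js i) (yc $ js i))"
    by (simp add: Psi_def)
  have Phi: "Phi xc js k xc = N / 2 * (norm (xc - x0))\<^sup>2 + A k * lr xc"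
    by (simp add: Phi_def sum_distrib_right[symmetric] sum_a[unfolded One_nat_def])
  have "A k = a 1 + (\<Sum>i=2..k. a i)"
    using k sum.atLeast_Suc_atMost[of 1 k a] by (simp add: sum_a[symmetric] numeral_2_eq_2)
  then have ms: "(\<Sum>i=2..k. mart yc js i + a i * (G (js i) (yc $ js i) - Gs yc))
     = (\<Sum>i=2..k. mart yc js i) + (\<Sum>i=2..k. a i * G (js i) (yc $ js i)) - (A k - a 1) * Gs yc"
    by (simp add: sum.distrib right_diff_distrib sum_subtractf sum_distrib_right)
  have "a k * (R * norm ?D * norm (Y js k - yc)) \<le> N / 4 * (norm (Y js k - yc))\<^sup>2 + ?c / 4 * (norm ?D)\<^sup>2"
    using N2 R sigma st.ak_le_sqrt[of "k - 1"] st.Ak_nonneg[of "k - 1"] k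
    by (intro weighted_AM_GM) auto
  moreover have "- (R * norm ?D * norm (Y js k - yc)) \<le> Bmat b ?D \<bullet> (Y js k - yc)"
    using Bmat_bound[of ?D "Y js k - yc"] by linarith
  then have "a k * - (R * norm ?D * norm (Y js k - yc)) \<le> a k * (Bmat b ?D \<bullet> (Y js k - yc))"
    using st.ak_pos[OF k] by (intro mult_left_mono) auto
  ultimately have E: "a k * (Bmat b ?D \<bullet> (Y js k - yc)) \<ge> - (N / 4 * (norm (yc - Y js k))\<^sup>2 + ?c / 4 * (norm ?D)\<^sup>2)"
    by (simp add: norm_minus_commute)
  have "N / 2 * (norm (yc - Y js k))\<^sup>2 = N / 4 * (norm (yc - Y js k))\<^sup>2 + N / 4 * (norm (yc - Y js k))\<^sup>2"
    "N * ((norm (xc - x0))\<^sup>2 + (norm (yc - y0))\<^sup>2) / 2 = N / 2 * (norm (xc - x0))\<^sup>2 + N / 2 * (norm (yc - y0))\<^sup>2"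
    by (simp_all add: distrib_left add_divide_distrib)
  then show ?thesis
    using Psi_growth[OF k yc, of yc js] Phi_growth[OF k xc, of xc js] estimate_lower_bound[OF k, where yc = yc and xc = xc and js = js] E
    unfolding Psi Phi ms by (simp only: distrib_left left_diff_distrib)
qed

section \<open>Averaging over the random indices\<close>

lemma noise_fun_upd:
  assumes "i \<ge> 2"
  shows "noise yc (js(i := c)) i j = noise yc js i j"
proof -
  have X: "X (js(i := c)) k = X js k" and Y: "Y (js(i := c)) k = Y js k" if "k < i" for k
    unfolding xk_def yk_def using that by (simp_all add: vrpda_cong[of k "js(i := c)" js])
  show ?thesis using assms by (simp add: noise_def Xb_def X Y)
qed

lemma sum_mart:
  assumes "i \<in> {2..k}"
  shows "(\<Sum>js\<in>PiE {2..k} (\<lambda>_. UNIV). mart yc js i) = 0"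
  unfolding mart_def
proof (rule sum_PiE_centered[where f = "\<lambda>js j. a i * (noise yc js i j - (\<Sum>j\<in>UNIV. noise yc js i j) / N)"])
  fix js
  have "(\<Sum>j\<in>UNIV. a i * (noise yc js i j - (\<Sum>j\<in>UNIV. noise yc js i j) / N))
      = a i * ((\<Sum>j\<in>UNIV. noise yc js i j) - N * ((\<Sum>j\<in>UNIV. noise yc js i j) / N))"
    by (simp add: sum_distrib_left[symmetric] sum_subtractf N_def)
  then show "(\<Sum>j\<in>UNIV. a i * (noise yc js i j - (\<Sum>j\<in>UNIV. noise yc js i j) / N)) = 0"
    using N2 by simp
qed (use assms noise_fun_upd in auto)

lemma Exp_r_le:
  assumes "k \<ge> 1" "\<And>js. f js + (\<Sum>i=2..k. mart yc js i) \<le> C"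
  shows "Exp_r k f \<le> C"
proof -
  let ?P = "PiE {2..k} (\<lambda>_. UNIV :: 'n set)"
  have "(\<Sum>js\<in>?P. \<Sum>i=2..k. mart yc js i) = (\<Sum>i=2..k. \<Sum>js\<in>?P. mart yc js i)" by (rule sum.swap)
  also have "\<dots> = 0" using sum_mart by (intro sum.neutral) auto
  finally have "(\<Sum>js\<in>?P. f js) = (\<Sum>js\<in>?P. f js + (\<Sum>i=2..k. mart yc js i))"
    by (simp add: sum.distrib)
  also have "\<dots> \<le> (\<Sum>js\<in>?P. C)" using assms(2) by (intro sum_mono)
  also have "\<dots> = N ^ (k - 1) * C" using assms(1) by (simp add: card_PiE N_def numeral_2_eq_2)
  finally have "(\<Sum>js\<in>?P. f js) \<le> N ^ (k - 1) * C" .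
  moreover have "N ^ (k - 1) > 0" using N2 by simp
  ultimately show ?thesis unfolding Exp_r_def N_def[symmetric] by (simp add: field_simps)
qed

section \<open>Summation by parts and the averaged iterates\<close>

definition "weight k i = (if i = k then N * a k else N * a i - (N - 1) * a (Suc i))"

text \<open>This is the purpose of the first branch of the step size rule: it makes
  \<open>ytil\<close> a convex combination.\<close>

lemma weight_nonneg: "i \<in> {2..k} \<Longrightarrow> weight k i \<ge> 0"
  using st.ak_Suc_le[of i] st.ak_pos[of k] N2 by (auto simp: weight_def)

text \<open>Summation by parts. The contribution of h 1 vanishes because (N - 1) * a 2 = a 1, so y_1
  does not occur in \<open>ytil\<close>.\<close>

lemma sum_weight:
  assumes "k \<ge> 2"
  shows "(\<Sum>i=2..k. weight k i * h i) = a 1 * h 1 + (\<Sum>i=2..k. a i * (N * h i - (N - 1) * h (i - 1)))"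
  using assms
proof (induction k rule: dec_induct)
  case base
  have "(N - 1) * a 2 = a 1" using N2 by (simp add: ak_2 ak_1)
  then have "(N - 1) * (a 2 * h 1) = a 1 * h 1" by (metis mult.assoc)
  then show ?case by (simp add: weight_def algebra_simps)
next
  case (step k)
  have "(\<Sum>i=2..k. weight (Suc k) i * h i) = (\<Sum>i=2..k. weight k i * h i) - (N - 1) * a (Suc k) * h k"
  proof -
    have "(\<Sum>i=2..k. weight (Suc k) i * h i) = (\<Sum>i=2..k. weight k i * h i - (if i = k then (N - 1) * a (Suc k) * h k else 0))"
      by (intro sum.cong) (auto simp: weight_def algebra_simps)
    then show ?thesis using step.hyps by (simp add: sum_subtractf)
  qed
  then show ?case using step by (simp add: weight_def algebra_simps)
qed

lemma sum_weight_1: "k \<ge> 2 \<Longrightarrow> (\<Sum>i=2..k. weight k i) = A k"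
  using sum_weight[of k "\<lambda>_. 1"] sum.atLeast_Suc_atMost[of 1 k a]
  by (simp add: sum_a[symmetric] numeral_2_eq_2)

abbreviation "xt \<equiv> xtil b g ell R \<sigma> x0 y0 u v"
abbreviation "yt \<equiv> ytil b g ell R \<sigma> x0 y0 u v"

lemma xt_eq: "xt js k = (1 / A k) *\<^sub>R (\<Sum>i=1..k. a i *\<^sub>R X js i)"
  by (simp add: xtil_def Let_def N_def)

lemma yt_eq:
  assumes "k \<ge> 2"
  shows "yt js k = (1 / A k) *\<^sub>R (\<Sum>i=2..k. weight k i *\<^sub>R Y js i)"
proof -
  obtain m where m: "k = Suc m" using assms by (cases k) auto
  have "(\<Sum>i=2..k. weight k i *\<^sub>R Y js i) = (N * a k) *\<^sub>R Y js k + (\<Sum>i=2..k-1. weight k i *\<^sub>R Y js i)"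
    using assms by (simp add: m weight_def)
  also have "(\<Sum>i=2..k-1. weight k i *\<^sub>R Y js i) = (\<Sum>i=2..k-1. (N * a i - (N - 1) * a (i + 1)) *\<^sub>R Y js i)"
    using assms by (intro sum.cong) (auto simp: weight_def)
  finally show ?thesis by (simp add: ytil_def Let_def flip: N_def)
qed

lemma convex_primal: "convex_on DL (\<lambda>x. Bmat b x \<bullet> yc + lr x)"
proof -
  have "closed_strongly_convex (0 + \<sigma>) (UNIV \<inter> DL) (\<lambda>x. (x \<bullet> BT b yc + 0) + lr x)"
    by (intro closed_strongly_convex_add closed_strongly_convex_affine csc_ell)
  from closed_strongly_convex_convex_on[OF this] show ?thesis
    using sigma by (simp add: inner_commute[of _ "BT b yc"] inner_BT)
qed

lemma convex_dual: "convex_on DG (Hf xc)"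
proof -
  have "closed_strongly_convex (0 + 0) (DG \<inter> UNIV) (\<lambda>y. Gs y + (y \<bullet> (- Bmat b xc) + 0))"
    by (intro closed_strongly_convex_add closed_strongly_convex_affine csc_Gs)
  from closed_strongly_convex_convex_on[OF this] show ?thesis
    by (simp add: Hf_def[abs_def] inner_commute)
qed

lemma xt_mean:
  assumes "k \<ge> 2"
  shows "xt js k \<in> DL"
    and "A k * (Bmat b (xt js k) \<bullet> yc + lr (xt js k)) \<le> (\<Sum>i=1..k. a i * (Bmat b (X js i) \<bullet> yc + lr (X js i)))"
  using assms convex_weighted_mean[OF convex_primal, of "{1..k}" a "A k" "X js"] st.ak_pos st.Ak_pos[of k] X_in_DL
  unfolding xt_eq by (auto simp: sum_a[unfolded One_nat_def] less_imp_le)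

lemma yt_mean:
  assumes "k \<ge> 2"
  shows "yt js k \<in> DG" and "A k * Hf xc (yt js k) \<le> (\<Sum>i=2..k. weight k i * Hf xc (Y js i))"
  using assms convex_weighted_mean[OF convex_dual, of "{2..k}" "weight k" "A k" "Y js"] weight_nonneg
    sum_weight_1 st.Ak_pos[of k] Y_in_DG
  unfolding yt_eq[OF assms] by auto

section \<open>The bounds in expectation\<close>

definition "Lagr x y = Bmat b x \<bullet> y - Gs y + lr x"

lemma Lag_eq: "x \<in> DL \<Longrightarrow> y \<in> DG \<Longrightarrow> Lag b g ell x y = ereal (Lagr x y)"
  by (simp add: Lag_def Lagr_def gstar_eq ell_eq)

lemma pathwise_gap_bound:
  assumes k: "k \<ge> 2" and xc: "xc \<in> DL" and yc: "yc \<in> DG"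
  shows "N / 4 * (norm (yc - Y js k))\<^sup>2 + (N + \<sigma> * A k) / 2 * (norm (xc - X js k))\<^sup>2
     + A k * (Lagr (xt js k) yc - Lagr xc (yt js k)) + (\<Sum>i=2..k. mart yc js i)
     \<le> N * ((norm (xc - x0))\<^sup>2 + (norm (yc - y0))\<^sup>2) / 2"
proof -
  have "gap_sum xc yc js k = (\<Sum>i=1..k. a i * (Bmat b (X js i) \<bullet> yc + lr (X js i)))
      + (\<Sum>i=2..k. weight k i * Hf xc (Y js i))"
    unfolding gap_sum_def sum_weight[OF k] by simp
  moreover have "A k * (Lagr (xt js k) yc - Lagr xc (yt js k))
      = A k * (Bmat b (xt js k) \<bullet> yc + lr (xt js k)) + A k * Hf xc (yt js k) - A k * (lr xc + Gs yc)"
    by (simp add: Lagr_def Hf_def algebra_simps)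
  ultimately have "A k * (Lagr (xt js k) yc - Lagr xc (yt js k)) \<le> gap_sum xc yc js k - A k * (lr xc + Gs yc)"
    using xt_mean(2)[OF k, of js yc] yt_mean(2)[OF k, of xc js] by linarith
  then show ?thesis using pathwise_bound[of k xc yc js] k xc yc by linarith
qed

theorem expected_gap:
  assumes k: "k \<ge> 2" and xc: "xc \<in> DL" and yc: "yc \<in> DG"
  shows "Exp_e k (\<lambda>js. Gap b g ell xc yc (xt js k) (yt js k))
    \<le> ereal (N * ((norm (xc - x0))\<^sup>2 + (norm (yc - y0))\<^sup>2) / (2 * A k))"
proof -
  let ?f = "\<lambda>js. Lagr (xt js k) yc - Lagr xc (yt js k)"
  let ?C = "N * ((norm (xc - x0))\<^sup>2 + (norm (yc - y0))\<^sup>2) / 2"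
  \<comment> \<open>The averages stay in the domains, so the gap is finite and the extended
    expectation is a real one.\<close>
  have "Gap b g ell xc yc (xt js k) (yt js k) = ereal (?f js)" for js
    using xt_mean(1)[OF k] yt_mean(1)[OF k] xc yc by (simp add: Gap_def Lag_eq)
  then have E: "Exp_e k (\<lambda>js. Gap b g ell xc yc (xt js k) (yt js k)) = ereal (Exp_r k ?f)"
    by (simp add: Exp_e_def Exp_r_def)
  have Ak: "A k > 0" using st.Ak_pos k by simp
  have "Exp_r k (\<lambda>js. A k * ?f js) \<le> ?C"
  proof (rule Exp_r_le)
    fix js
    have "0 \<le> N / 4 * (norm (yc - Y js k))\<^sup>2" "0 \<le> (N + \<sigma> * A k) / 2 * (norm (xc - X js k))\<^sup>2"
      using N2 sigma Ak by simp_all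
    then show "A k * ?f js + (\<Sum>i=2..k. mart yc js i) \<le> ?C"
      using pathwise_gap_bound[OF assms, of js] by linarith
  qed (use k in simp)
  moreover have "Exp_r k (\<lambda>js. A k * ?f js) = A k * Exp_r k ?f"
    by (simp add: Exp_r_def sum_distrib_left[symmetric])
  ultimately have "Exp_r k ?f \<le> ?C / A k" using Ak by (simp add: pos_le_divide_eq mult.commute)
  then show ?thesis unfolding E by (simp add: mult.commute)
qed

theorem expected_distance:
  assumes k: "k \<ge> 2" and sp: "saddle_point b g ell xc yc"
  shows "Exp_r k (\<lambda>js. N / 4 * (norm (yc - Y js k))\<^sup>2 + (N + \<sigma> * A k) / 2 * (norm (xc - X js k))\<^sup>2)
    \<le> N * ((norm (xc - x0))\<^sup>2 + (norm (yc - y0))\<^sup>2) / 2"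
proof (rule Exp_r_le)
  fix js
  have c: "xc \<in> DL" "yc \<in> DG" using sp by (auto simp: saddle_point_def)
  have "Lag b g ell xc (yt js k) \<le> Lag b g ell (xt js k) yc"
    using sp xt_mean(1)[OF k] yt_mean(1)[OF k] unfolding saddle_point_def by (meson order_trans)
  then have "Lagr (xt js k) yc - Lagr xc (yt js k) \<ge> 0"
    using xt_mean(1)[OF k] yt_mean(1)[OF k] c by (simp add: Lag_eq)
  then have "A k * (Lagr (xt js k) yc - Lagr xc (yt js k)) \<ge> 0" using st.Ak_nonneg by simp
  then show "N / 4 * (norm (yc - Y js k))\<^sup>2 + (N + \<sigma> * A k) / 2 * (norm (xc - X js k))\<^sup>2
      + (\<Sum>i=2..k. mart yc js i) \<le> N * ((norm (xc - x0))\<^sup>2 + (norm (yc - y0))\<^sup>2) / 2"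
    using pathwise_gap_bound[OF k c, of js] by linarith
qed (use k in simp)

end

theorem theorem2:
  fixes b :: "'n::finite \<Rightarrow> real^'d" and g :: "'n \<Rightarrow> real \<Rightarrow> ereal"
    and ell :: "real^'d \<Rightarrow> ereal" and R \<sigma> :: real
    and x0 u xs :: "real^'d" and y0 v ys :: "real^'n" and K k :: nat
  assumes n2: "CARD('n) \<ge> 2"
    and R: "R > 0" and bnorm: "\<forall>i. norm (b i) \<le> R"
    and gconv: "\<forall>i. proper_fun (g i) \<and> lsc_fun (g i) \<and> convex_fun (g i)"
    and ell: "proper_fun ell" "lsc_fun ell" and sigma: "\<sigma> \<ge> 0" "strongly_convex_fun \<sigma> ell"
    and uv: "u \<in> edom ell" "v \<in> edom (gstar g)"
    and K: "K \<ge> 2" and k: "2 \<le> k" "k \<le> K"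
  shows
    "(Exp_e k (\<lambda>js. Gap b g ell u v (xtil b g ell R \<sigma> x0 y0 u v js k) (ytil b g ell R \<sigma> x0 y0 u v js k))
       \<le> ereal (real CARD('n) * ((norm (u - x0))\<^sup>2 + (norm (v - y0))\<^sup>2) / (2 * Ak (real CARD('n)) R \<sigma> k)))
   \<and> (saddle_point b g ell xs ys \<longrightarrow>
       Exp_r k (\<lambda>js. real CARD('n) / 4 * (norm (ys - yk b g ell R \<sigma> x0 y0 u v js k))\<^sup>2
                 + (real CARD('n) + \<sigma> * Ak (real CARD('n)) R \<sigma> k) / 2
                   * (norm (xs - xk b g ell R \<sigma> x0 y0 u v js k))\<^sup>2)
       \<le> real CARD('n) * ((norm (xs - x0))\<^sup>2 + (norm (ys - y0))\<^sup>2) / 2)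
   \<and> (let n = real CARD('n);
         K0 = \<lceil>ln n / (ln n - ln (n - 1))\<rceil>;
         Bn = \<sigma> * n * (n - 1) / (4 * R) + sqrt ((\<sigma> * n * (n - 1) / (4 * R))\<^sup>2 + n\<^sup>2);
         k0 = \<lceil>ln Bn / (ln n - ln (n - 1))\<rceil>
     in Ak n R \<sigma> k \<ge> max (max
            ((n - 1) / (2 * R) * (1 + 1 / (n - 1)) ^ k * of_bool (int k \<le> k0))
            ((n - 1)\<^sup>2 * \<sigma> / ((4 * R)\<^sup>2 * n) * (real k - real_of_int k0 + n - 1)\<^sup>2 * of_bool (int k \<ge> k0)))
            (n * (real k - real_of_int K0 + n - 1) / (2 * R) * of_bool (int k \<ge> K0))
        \<and> Bn \<ge> n * max 1 (\<sigma> * (n - 1) / (2 * R)))"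
proof -
  interpret vrpda_problem b g ell R \<sigma> x0 u y0 v "real CARD('n)"
    using n2 R bnorm gconv ell sigma uv by unfold_locales auto
  show ?thesis
    using expected_gap[OF k(1) uv] expected_distance[OF k(1), of xs ys]
      st.Ak_lower_bound[OF k(1)] st.Bn_ge
    unfolding Let_def by blast
qed

end
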